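(* Let $T:\mathbb{N}\to\mathbb{R}_{\ge0}$ be a function such that $T(n)=\Omega(n\log n)$ and $T(n)\ge n+1$ for all $n\in\mathbb{N}$. Then there is no algorithm that, given a one-tape Turing machine $M$, decides whether $M$ runs in time $T(n)$.
   Context: $\mathbb{N}=\{0,1,2,\dots\}$; $\log$ is base $2$. $f(n)=\Omega(g(n))$ means there exist $k>0$ and $n_0$ with $f(n)\ge k\,g(n)$ for all $n\ge n_0$. Turing machines are deterministic. A one-tape Turing machine has a single both-way infinite read-write tape which also holds the input, and its head moves (left or right) at every step. A Turing machine $M$ runs in time $T(n)$ if for every $n$, $M$ makes at most $T(n)$ steps on every input of length $n$. *)

theory Defs
  imports Complex_Main "HOL-Library.Landau_Symbols"
begin

text \<open>
  A machine has to be a finite object that can be handed to an algorithm, so states and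
  tape symbols are initial segments of the naturals: the states are \<open>{0..<num_states M}\<close>,
  the tape alphabet is \<open>{0..<num_symbols M}\<close>, the blank is \<open>0\<close>, and the input alphabet is
  \<open>{1..num_inputs M}\<close>.  The values of \<open>delta\<close> in the two halting states, or outside of the
  states and tape symbols, are irrelevant.
\<close>

datatype move = MLeft | MRight

record tm =
  num_states :: nat
  num_inputs :: nat
  num_symbols :: nat
  start :: nat
  acc :: nat
  rej :: nat
  delta :: "nat \<Rightarrow> nat \<Rightarrow> nat \<times> nat \<times> move"

definition halting :: "tm \<Rightarrow> nat \<Rightarrow> bool" where
  "halting M q \<longleftrightarrow> q = acc M \<or> q = rej M"

definition wf_tm :: "tm \<Rightarrow> bool" where
  "wf_tm M \<longleftrightarrow>
     1 \<le> num_inputs M \<and> num_inputs M < num_symbols M \<and>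
     start M < num_states M \<and> acc M < num_states M \<and> rej M < num_states M \<and> acc M \<noteq> rej M \<and>
     (\<forall>q < num_states M. \<not> halting M q \<longrightarrow>
        (\<forall>a < num_symbols M.
           case delta M q a of (q', b, m) \<Rightarrow> q' < num_states M \<and> b < num_symbols M))"

definition inputs :: "tm \<Rightarrow> nat list set" where
  "inputs M = lists {1..num_inputs M}"

record config =
  state :: nat
  head :: int
  tape :: "int \<Rightarrow> nat"

text \<open>The head starts on the leftmost input symbol (on a blank if the input is empty).\<close>

definition init_config :: "tm \<Rightarrow> nat list \<Rightarrow> config" where
  "init_config M w =
     \<lparr>state = start M, head = 0,
      tape = (\<lambda>i. if 0 \<le> i \<and> i < int (length w) then w ! nat i else 0)\<rparr>"

definition step :: "tm \<Rightarrow> config \<Rightarrow> config" where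
  "step M c =
     (if halting M (state c) then c
      else case delta M (state c) (tape c (head c)) of (q, b, m) \<Rightarrow>
        \<lparr>state = q,
         head = (case m of MLeft \<Rightarrow> head c - 1 | MRight \<Rightarrow> head c + 1),
         tape = (tape c)(head c := b)\<rparr>)"

definition run :: "tm \<Rightarrow> nat list \<Rightarrow> nat \<Rightarrow> config" where
  "run M w t = (step M ^^ t) (init_config M w)"

text \<open>
  A halted configuration is a fixed point of \<open>step\<close>, so \<open>M\<close> makes at most \<open>t\<close> steps on \<open>w\<close>
  iff \<open>run M w t\<close> is halted.
\<close>

definition makes_at_most_steps :: "tm \<Rightarrow> nat list \<Rightarrow> nat \<Rightarrow> bool" where
  "makes_at_most_steps M w t \<longleftrightarrow> halting M (state (run M w t))"

definition runs_in_time :: "tm \<Rightarrow> (nat \<Rightarrow> real) \<Rightarrow> bool" where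
  "runs_in_time M T \<longleftrightarrow>
     (\<forall>n. \<forall>w \<in> inputs M. length w = n \<longrightarrow>
        (\<exists>t. real t \<le> T n \<and> makes_at_most_steps M w t))"

definition accepts :: "tm \<Rightarrow> nat list \<Rightarrow> bool" where
  "accepts M w \<longleftrightarrow> (\<exists>t. state (run M w t) = acc M)"

definition rejects :: "tm \<Rightarrow> nat list \<Rightarrow> bool" where
  "rejects M w \<longleftrightarrow> (\<exists>t. state (run M w t) = rej M)"

text \<open>
  Machines are encoded as words over the two-letter alphabet \<open>{1, 2}\<close>: the parameters and the
  transition table, in lexicographic order of state and symbol and without the rows of the
  halting states, form a list of naturals, and each entry \<open>k\<close> becomes the block
  \<open>1 \<dots> 1 2\<close> with \<open>k\<close> ones.
\<close>

fun move_code :: "move \<Rightarrow> nat" where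
  "move_code MLeft = 0"
| "move_code MRight = 1"

definition table :: "tm \<Rightarrow> nat list" where
  "table M =
     concat (map (\<lambda>q. concat (map (\<lambda>a. case delta M q a of (q', b, m) \<Rightarrow> [q', b, move_code m])
                                [0..<num_symbols M]))
              (filter (\<lambda>q. \<not> halting M q) [0..<num_states M]))"

definition description :: "tm \<Rightarrow> nat list" where
  "description M =
     [num_states M, num_inputs M, num_symbols M, start M, acc M, rej M] @ table M"

definition encode :: "tm \<Rightarrow> nat list" where
  "encode M = concat (map (\<lambda>k. replicate k 1 @ [2]) (description M))"

text \<open>
  An algorithm is itself a one-tape Turing machine.  It is given a machine, so nothing is
  required of it on words that do not encode a machine.
\<close>

definition decides :: "tm \<Rightarrow> (tm \<Rightarrow> bool) \<Rightarrow> bool" where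
  "decides D P \<longleftrightarrow>
     wf_tm D \<and> 2 \<le> num_inputs D \<and>
     (\<forall>M. wf_tm M \<longrightarrow> (P M \<longrightarrow> accepts D (encode M)) \<and> (\<not> P M \<longrightarrow> rejects D (encode M)))"

text \<open>The encoding determines the machine, up to the irrelevant values of \<open>delta\<close>.\<close>

lemma blocks_inject:
  assumes "concat (map (\<lambda>k. replicate k (1::nat) @ [2]) xs) =
           concat (map (\<lambda>k. replicate k 1 @ [2]) ys)"
  shows "xs = ys"
  using assms
proof (induction xs arbitrary: ys)
  case Nil
  then show ?case by (cases ys) auto
next
  case (Cons x xs)
  then obtain y ys' where ys: "ys = y # ys'" by (cases ys) auto
  have *: "x = y \<and> u = v" if "replicate x (1::nat) @ 2 # u = replicate y 1 @ 2 # v" for u v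
    using that
  proof (induction x arbitrary: y)
    case 0
    then show ?case by (cases y) auto
  next
    case (Suc x)
    then show ?case by (cases y) auto
  qed
  show ?case using Cons *[of "concat (map (\<lambda>k. replicate k 1 @ [2]) xs)"] by (auto simp: ys)
qed

lemma concat_map_inject:
  assumes "concat (map f xs) = concat (map g xs)" "\<And>x. x \<in> set xs \<Longrightarrow> length (f x) = length (g x)"
    and "x \<in> set xs"
  shows "f x = g x"
  using assms by (induction xs) auto

lemma encode_inject:
  assumes "encode M = encode M'"
  shows "num_states M = num_states M'" "num_inputs M = num_inputs M'"
    "num_symbols M = num_symbols M'" "start M = start M'" "acc M = acc M'" "rej M = rej M'"
    "\<lbrakk>q < num_states M; \<not> halting M q; a < num_symbols M\<rbrakk> \<Longrightarrow> delta M q a = delta M' q a"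
proof -
  have d: "description M = description M'"
    using assms blocks_inject unfolding encode_def by blast
  then show eqs: "num_states M = num_states M'" "num_inputs M = num_inputs M'"
    "num_symbols M = num_symbols M'" "start M = start M'" "acc M = acc M'" "rej M = rej M'"
    by (auto simp: description_def)
  have t: "table M = table M'" using d by (auto simp: description_def)
  have h: "halting M = halting M'" using eqs by (auto simp: halting_def fun_eq_iff)
  define entry where "entry = (\<lambda>(M::tm) q a. case delta M q a of (q', b, m) \<Rightarrow> [q', b, move_code m])"
  have len: "length (entry N q a) = 3" for N q a
    by (simp add: entry_def split: prod.split)
  have t': "table N = concat (map (\<lambda>q. concat (map (entry N q) [0..<num_symbols N]))
              (filter (\<lambda>q. \<not> halting N q) [0..<num_states N]))" for N
    by (simp add: table_def entry_def)
  show "delta M q a = delta M' q a"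
    if q: "q < num_states M" "\<not> halting M q" and a: "a < num_symbols M"
  proof -
    have row: "concat (map (entry M q) [0..<num_symbols M]) =
               concat (map (entry M' q) [0..<num_symbols M])"
      by (rule concat_map_inject[where xs = "filter (\<lambda>q. \<not> halting M q) [0..<num_states M]"
              and f = "\<lambda>q. concat (map (entry M q) [0..<num_symbols M])"
              and g = "\<lambda>q. concat (map (entry M' q) [0..<num_symbols M])"])
        (use t q in \<open>auto simp: t' eqs h length_concat len o_def\<close>)
    have "entry M q a = entry M' q a"
      by (rule concat_map_inject[OF row]) (use a len in auto)
    moreover have "move_code m = move_code m' \<longleftrightarrow> m = m'" for m m'
      by (cases m; cases m') auto
    ultimately show ?thesis by (auto simp: entry_def split: prod.splits)
  qed
qed

end

theory Submission
  imports Defs "HOL-Library.FuncSet"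
begin

text \<open>
  Suppose that \<open>D\<close> decides the property. By a quine construction there is a machine \<open>M\<close> that
  runs \<open>D\<close> on its own code and does the opposite of what \<open>D\<close> says: it loops if \<open>D\<close> accepts
  and halts in time if \<open>D\<close> rejects. The difficulty is the time bound, since the computation of \<open>D\<close>
  has to fit into a small multiple of \<open>n log n\<close>. On the input \<open>1\<^sup>n\<close>, \<open>M\<close> repeatedly sweeps over the
  input and keeps every \<open>B\<close>-th of the remaining marks, until none is left. If \<open>n < B\<close> this takes
  \<open>n + 1\<close> steps and \<open>M\<close> halts. Otherwise there are \<open>r\<close> successful sweeps, where \<open>B\<^sup>r \<le> n\<close>, so
  the sweeps cost \<open>O(n r)\<close> steps, which for large \<open>B\<close> is a small multiple of \<open>n log n\<close>. Each sweep also
  enlarges a blank region around the origin, which becomes \<open>{-r..<r}\<close>, and \<open>M\<close> finally simulates \<open>D\<close> inside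
  the region and halts if it has to leave it. No clock is needed: if \<open>D\<close> rejects, the unbounded
  computation halts, hence never repeats a configuration, and its part inside the region
  has at most \<open>|Q| 2 r S\<^sup>2\<^sup>r\<close> steps, for \<open>|Q|\<close> states and \<open>S\<close> symbols. Here \<open>|Q| \<le> 2 r\<close> can be
  assumed, because \<open>M\<close> first writes a word of length at least \<open>|Q| / 2\<close>, and then the bound is
  at most \<open>B\<^sup>r\<close>.  If \<open>D\<close> accepts, then the whole computation fits into the region for large \<open>r\<close>, and \<open>M\<close> loops.

  For the quine, the states of \<open>M\<close> are \<open>N\<close> states that do not depend on the word to be written,
  followed by a chain of states, each of which writes one letter. The word lists
  the transition table of the first \<open>N\<close> states, and the rest of the code of \<open>M\<close> is computed from it.
\<close>

section \<open>Runs of Turing machines\<close>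

definition zip_tape :: "nat \<Rightarrow> int \<Rightarrow> nat list \<Rightarrow> nat list \<Rightarrow> int \<Rightarrow> nat" where
  "zip_tape z p l r i =
     (if p \<le> i then if nat (i - p) < length r then r ! nat (i - p) else z
      else if nat (p - 1 - i) < length l then l ! nat (p - 1 - i) else z)"

text \<open>
  The head at position \<open>p\<close> reads the first letter of \<open>r\<close>, the letters to its left, read
  leftwards, are \<open>l\<close>, and all other cells hold \<open>z\<close>.
\<close>

definition conf :: "nat \<Rightarrow> int \<Rightarrow> nat \<Rightarrow> nat list \<Rightarrow> nat list \<Rightarrow> config" where
  "conf z p q l r = \<lparr>state = q, head = p, tape = zip_tape z p l r\<rparr>"

lemma state_conf [simp]: "state (conf z p q l r) = q"
  and head_conf [simp]: "head (conf z p q l r) = p"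
  and tape_conf [simp]: "tape (conf z p q l r) = zip_tape z p l r"
  by (auto simp: conf_def)

lemma zip_tape_Nil_right: "zip_tape z p l [] = zip_tape z p l [z]"
  by (auto simp: zip_tape_def fun_eq_iff)

lemma zip_tape_Nil_left: "zip_tape z p [] r = zip_tape z p [z] r"
  by (auto simp: zip_tape_def fun_eq_iff)

text \<open>Makes a blank beyond the listed letters explicit, so that the rules for single steps
  find a letter under the head.\<close>

lemma conf_Nil_right: "conf z p q l [] = conf z p q l [z]"
  by (simp add: conf_def zip_tape_Nil_right)

lemma conf_Nil_left: "conf z p q [] r = conf z p q [z] r"
  by (simp add: conf_def zip_tape_Nil_left)

lemma zip_tape_right:
  "(zip_tape z p l (a # r))(p := b) = zip_tape z (p + 1) (b # l) r"
proof
  fix i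
  consider "i = p" | "i > p" | "i < p" by linarith
  then show "((zip_tape z p l (a # r))(p := b)) i = zip_tape z (p + 1) (b # l) r i"
  proof cases
    case 2
    then have "nat (i - p) = Suc (nat (i - (p + 1)))" by linarith
    then show ?thesis using 2 by (auto simp: zip_tape_def)
  next
    case 3
    then have "nat (p + 1 - 1 - i) = Suc (nat (p - 1 - i))" by linarith
    then show ?thesis using 3 by (auto simp: zip_tape_def)
  qed (auto simp: zip_tape_def)
qed

lemma zip_tape_left:
  "(zip_tape z p (c # l) (a # r))(p := b) = zip_tape z (p - 1) l (c # b # r)"
proof
  fix i
  consider "i = p" | "i > p" | "i = p - 1" | "i < p - 1" by linarith
  then show "((zip_tape z p (c # l) (a # r))(p := b)) i = zip_tape z (p - 1) l (c # b # r) i"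
  proof cases
    case 2
    then have "nat (i - p) = Suc (nat (i - p - 1))" "nat (i - (p - 1)) = Suc (Suc (nat (i - p - 1)))"
      by linarith+
    then show ?thesis using 2 by (auto simp: zip_tape_def)
  next
    case 4
    then have "nat (p - 1 - i) = Suc (nat (p - 1 - 1 - i))" by linarith
    then show ?thesis using 4 by (auto simp: zip_tape_def)
  qed (auto simp: zip_tape_def)
qed

lemma zip_tape_head: "zip_tape z p l (a # r) p = a"
  by (simp add: zip_tape_def)

lemma step_conf_right:
  assumes "\<not> halting M q" "delta M q a = (q', b, MRight)"
  shows "step M (conf z p q l (a # r)) = conf z (p + 1) q' (b # l) r"
  using assms by (simp add: step_def conf_def zip_tape_head zip_tape_right)

lemma step_conf_left:
  assumes "\<not> halting M q" "delta M q a = (q', b, MLeft)"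
  shows "step M (conf z p q (c # l) (a # r)) = conf z (p - 1) q' l (c # b # r)"
  using assms by (simp add: step_def conf_def zip_tape_head zip_tape_left)

lemma conf_blank: "conf z p q [] [] = \<lparr>state = q, head = p, tape = (\<lambda>_. z)\<rparr>"
  by (simp add: conf_def zip_tape_def fun_eq_iff)

lemma conf_append_blank_left: "conf z p q (l @ [z]) r = conf z p q l r"
  by (auto simp: conf_def zip_tape_def fun_eq_iff nth_append nth_Cons split: nat.splits)

lemma conf_append_blank_right: "conf z p q l (r @ [z]) = conf z p q l r"
  by (auto simp: conf_def zip_tape_def fun_eq_iff nth_append nth_Cons split: nat.splits)

section \<open>Multi-step runs and scanning\<close>

definition steps :: "tm \<Rightarrow> nat \<Rightarrow> config \<Rightarrow> config \<Rightarrow> bool" where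
  "steps M t c c' \<longleftrightarrow> (step M ^^ t) c = c'"

lemma steps_0: "steps M 0 c c"
  by (simp add: steps_def)

lemma steps_1: "step M c = c' \<Longrightarrow> steps M 1 c c'"
  by (simp add: steps_def)

lemma steps_add: "steps M t c c' \<Longrightarrow> steps M u c' c'' \<Longrightarrow> steps M (t + u) c c''"
  by (simp add: steps_def add.commute[of t u] funpow_add)

lemma steps_Suc: "step M c = c' \<Longrightarrow> steps M t c' c'' \<Longrightarrow> steps M (Suc t) c c''"
  using steps_add[OF steps_1] by simp

text \<open>Step counts matter for the sweeps and the chain. The time for the queue and for
  simulating \<open>D\<close> is bounded later by counting configurations, so reachability suffices
  there.\<close>

definition reach :: "tm \<Rightarrow> config \<Rightarrow> config \<Rightarrow> bool" where
  "reach M c c' \<longleftrightarrow> (\<exists>t. steps M t c c')"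

lemma reachI: "steps M t c c' \<Longrightarrow> reach M c c'"
  by (auto simp: reach_def)

lemma reach_refl: "reach M c c"
  using steps_0 by (auto simp: reach_def)

lemma reach_trans: "reach M c c' \<Longrightarrow> reach M c' c'' \<Longrightarrow> reach M c c''"
  unfolding reach_def using steps_add by blast

lemma reach_step: "step M c = c' \<Longrightarrow> reach M c c'"
  using steps_1 by (auto simp: reach_def)

lemma scan_right:
  assumes "\<not> halting M q" "\<And>a. a \<in> set u \<Longrightarrow> delta M q a = (q, a, MRight)"
  shows "steps M (length u) (conf z p q l (u @ r)) (conf z (p + int (length u)) q (rev u @ l) r)"
  using assms(2)
proof (induction u arbitrary: p l)
  case (Cons a u)
  have "step M (conf z p q l ((a # u) @ r)) = conf z (p + 1) q (a # l) (u @ r)"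
    using step_conf_right[OF assms(1)] Cons.prems by simp
  moreover have "steps M (length u) (conf z (p + 1) q (a # l) (u @ r))
      (conf z (p + 1 + int (length u)) q (rev u @ a # l) r)"
    using Cons.IH Cons.prems by simp
  ultimately show ?case using steps_Suc by (fastforce simp: algebra_simps)
qed (simp add: steps_0)

text \<open>Nothing is assumed about \<open>c\<close>, the letter on which the scan ends.\<close>

lemma scan_left:
  assumes "\<not> halting M q" "\<And>b. b \<in> set (a # u) \<Longrightarrow> delta M q b = (q, b, MLeft)"
  shows "steps M (Suc (length u)) (conf z p q (u @ c # l) (a # r))
           (conf z (p - 1 - int (length u)) q l (c # rev u @ a # r))"
  using assms(2)
proof (induction u arbitrary: p a r)
  case Nil
  then show ?case using steps_1[OF step_conf_left[OF assms(1)]] by simp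
next
  case (Cons b u)
  have "step M (conf z p q ((b # u) @ c # l) (a # r)) = conf z (p - 1) q (u @ c # l) (b # a # r)"
    using step_conf_left[OF assms(1)] Cons.prems by simp
  moreover have "steps M (Suc (length u)) (conf z (p - 1) q (u @ c # l) (b # a # r))
     (conf z (p - 1 - 1 - int (length u)) q l (c # rev u @ b # a # r))"
    using Cons.IH[of b "p - 1" "a # r"] Cons.prems by simp
  ultimately show ?case using steps_Suc by (fastforce simp: algebra_simps)
qed

section \<open>Halting time inside a bounded region\<close>

definition wf_config :: "tm \<Rightarrow> config \<Rightarrow> bool" where
  "wf_config M c \<longleftrightarrow> state c < num_states M \<and> (\<forall>i. tape c i < num_symbols M)"

lemma wf_config_step:
  assumes "wf_tm M" "wf_config M c"
  shows "wf_config M (step M c)"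
proof (cases "halting M (state c)")
  case False
  obtain q' b mv where d: "delta M (state c) (tape c (head c)) = (q', b, mv)"
    by (cases "delta M (state c) (tape c (head c))")
  have "q' < num_states M \<and> b < num_symbols M"
    using assms False d unfolding wf_tm_def wf_config_def by (metis (no_types, lifting) case_prod_conv)
  then show ?thesis using assms(2) d False by (auto simp: step_def wf_config_def)
qed (use assms in \<open>simp add: step_def\<close>)

lemma wf_config_funpow: "wf_tm M \<Longrightarrow> wf_config M c \<Longrightarrow> wf_config M ((step M ^^ t) c)"
  by (induction t) (auto intro: wf_config_step)

lemma funpow_step_halted: "halting M (state c) \<Longrightarrow> (step M ^^ k) c = c"
  by (induction k) (auto simp: step_def)

lemma halted_mono:
  assumes "halting M (state ((step M ^^ s) c))" "s \<le> t"
  shows "halting M (state ((step M ^^ t) c))"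
proof -
  obtain k where "t = k + s" using assms(2) le_Suc_ex add.commute by metis
  then show ?thesis using assms(1) funpow_step_halted[OF assms(1)] by (simp add: funpow_add)
qed

text \<open>A repeated configuration would prevent the machine from halting.\<close>

lemma configs_distinct:
  assumes halts: "halting M (state ((step M ^^ h) c))"
    and "i < j" "(step M ^^ i) c = (step M ^^ j) c"
  shows "halting M (state ((step M ^^ i) c))"
proof -
  define d where "d = (step M ^^ i) c"
  obtain k where k: "j = k + i" "0 < k" using assms(2) less_imp_add_positive add.commute by metis
  then have per: "(step M ^^ k) d = d" using assms(3) by (simp add: d_def funpow_add)
  have "(step M ^^ (k * n)) d = d" for n
    by (induction n) (auto simp: funpow_add per)
  \<comment> \<open>As \<open>0 < k\<close>, the multiple \<open>k * h\<close> of the period carries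
    the run past time \<open>h\<close>.\<close>
  moreover have "halting M (state ((step M ^^ (k * h)) d))"
  proof -
    have "h \<le> k * h + i" using k(2) by (simp add: trans_le_add1)
    moreover have "(step M ^^ (k * h)) d = (step M ^^ (k * h + i)) c" by (simp add: d_def funpow_add)
    ultimately show ?thesis using halted_mono[OF halts] by metis
  qed
  ultimately show ?thesis by (simp add: d_def)
qed

text \<open>Before time \<open>t\<close> no cell outside \<open>R\<close> is written, so a
  configuration is determined by its state, its head position and its tape on \<open>R\<close>. The
  machine halts eventually, possibly long after leaving \<open>R\<close>, hence no configuration
  repeats, and counting these triples gives the bound.\<close>

lemma halting_time_bound:
  fixes R :: "int set"
  assumes "wf_tm M" "wf_config M c" and halts: "halting M (state ((step M ^^ h) c))"
    and fin: "finite R"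
    and R: "\<And>s. s < t \<Longrightarrow> \<not> halting M (state ((step M ^^ s) c)) \<and> head ((step M ^^ s) c) \<in> R"
  shows "t \<le> num_states M * card R * num_symbols M ^ card R"
proof -
  define conf_at where "conf_at s = (step M ^^ s) c" for s
  define A where "A = {..<num_states M} \<times> R \<times> (R \<rightarrow>\<^sub>E {..<num_symbols M})"
  define f where "f s = (state (conf_at s), head (conf_at s), restrict (tape (conf_at s)) R)" for s
  have outside: "tape (conf_at s) i = tape c i" if "s \<le> t" "i \<notin> R" for s i
    using that(1)
  proof (induction s)
    case (Suc s)
    then have "head (conf_at s) \<in> R" using R[of s] by (simp add: conf_at_def)
    then have "tape (step M (conf_at s)) i = tape (conf_at s) i"
      using that(2) by (auto simp: step_def split: prod.splits)
    then show ?case using Suc by (simp add: conf_at_def)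
  qed (simp add: conf_at_def)
  have "inj_on f {..<t}"
  proof (rule inj_onI)
    fix i j
    assume ij: "i \<in> {..<t}" "j \<in> {..<t}" "f i = f j"
    have "tape (conf_at i) x = tape (conf_at j) x" for x
    proof (cases "x \<in> R")
      case True
      then show ?thesis using ij(3) by (auto simp: f_def restrict_def fun_eq_iff split: if_splits)
    next
      case False
      then show ?thesis using outside[of i x] outside[of j x] ij(1,2) by simp
    qed
    then have eq: "conf_at i = conf_at j" using ij(3) by (auto simp: f_def intro!: config.equality)
    show "i = j"
    proof (rule ccontr)
      assume "i \<noteq> j"
      then have "halting M (state (conf_at (min i j)))"
        using configs_distinct[OF halts, of i j] configs_distinct[OF halts, of j i] eq
        unfolding conf_at_def by (cases "i < j") (auto simp: min_def)
      then show False using R[of "min i j"] ij(1,2) by (simp add: conf_at_def min_def split: if_splits)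
    qed
  qed
  moreover have "f ` {..<t} \<subseteq> A"
  proof
    fix y
    assume "y \<in> f ` {..<t}"
    then obtain s where s: "s < t" "y = f s" by auto
    have "wf_config M (conf_at s)" unfolding conf_at_def using wf_config_funpow[OF assms(1,2)] .
    then show "y \<in> A" using s R[of s] by (auto simp: f_def A_def wf_config_def conf_at_def)
  qed
  moreover have "finite A" using fin by (simp add: A_def finite_PiE)
  ultimately have "card {..<t} \<le> card A" by (intro card_inj_on_le)
  then show ?thesis using fin by (simp add: A_def card_cartesian_product card_PiE)
qed

section \<open>The machine\<close>

datatype control =
    Rej | Acc
  | Sweep nat nat | Return | Extend | Convert | Final
  | Write nat | Letter nat
  | Pop nat | Push nat nat nat | Back nat
  | Sim nat | Loop

text \<open>
  Symbol \<open>0\<close> is the blank of the machine, \<open>1\<close> a mark, \<open>2\<close> an erased mark. The other symbols only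
  occur in the region around \<open>origin\<close>, where \<open>blank\<close> plays the role of the blank of \<open>D\<close>;
  \<open>one\<close> and \<open>two\<close> stand for the letters \<open>1\<close> and \<open>2\<close> of a code.
\<close>

abbreviation (input) blank :: nat where "blank \<equiv> 3"
abbreviation (input) origin :: nat where "origin \<equiv> 4"
abbreviation (input) unit :: nat where "unit \<equiv> 5"
abbreviation (input) pending :: nat where "pending \<equiv> 6"
abbreviation (input) hash :: nat where "hash \<equiv> 7"
abbreviation (input) dollar :: nat where "dollar \<equiv> 8"
abbreviation (input) counter :: nat where "counter \<equiv> 9"
abbreviation (input) fin :: nat where "fin \<equiv> 10"
abbreviation (input) one :: nat where "one \<equiv> 11"
abbreviation (input) two :: nat where "two \<equiv> 12"

text \<open>The shift by 10 keeps the letters of \<open>D\<close> apart from the working symbols and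
  sends the code letters 1 and 2 to \<open>one\<close> and \<open>two\<close>.\<close>

definition enc_sym :: "nat \<Rightarrow> nat" where
  "enc_sym a = (if a = 0 then blank else a + 10)"

text \<open>Truncated subtraction sends \<open>blank\<close> to 0. The other working symbols go to 0
  too, so every tape symbol decodes to a symbol of \<open>D\<close>.\<close>

definition dec_sym :: "nat \<Rightarrow> nat" where
  "dec_sym a = a - 10"

lemma dec_enc_sym [simp]: "dec_sym (enc_sym a) = a"
  by (simp add: enc_sym_def dec_sym_def)

lemma enc_sym_ge: "3 \<le> enc_sym a"
  by (simp add: enc_sym_def)

definition code :: "nat list \<Rightarrow> nat list" where
  "code ks = concat (map (\<lambda>k. replicate k one @ [two]) ks)"

lemma code_simps [simp]:
  "code [] = []" "code (k # ks) = replicate k one @ two # code ks" "code (xs @ ys) = code xs @ code ys"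
  by (simp_all add: code_def)

lemma set_code: "set (code ks) \<subseteq> {one, two}"
  by (induction ks) auto

lemma map_encode: "map enc_sym (encode M) = code (description M)"
proof -
  have "map enc_sym (concat (map (\<lambda>k. replicate k 1 @ [2]) ks)) = code ks" for ks
    by (induction ks) (auto simp: enc_sym_def)
  then show ?thesis by (simp add: encode_def)
qed

text \<open>\<open>B\<close> is the thinning factor of the sweeps. It is fixed only at the end, when
  \<open>D\<close> and the constants in the growth of \<open>T\<close> are known.\<close>

locale construction =
  fixes D :: tm and B :: nat
  assumes wf_D: "wf_tm D" and two_inputs: "2 \<le> num_inputs D" and two_le_B: "2 \<le> B"
begin

text \<open>Independent of \<open>B\<close>, so that \<open>B\<close> can be chosen large compared
  with \<open>S\<close>.\<close>

definition S :: nat where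
  "S = num_symbols D + 10"

lemma S_gt: "12 < S"
  using wf_D two_inputs by (auto simp: S_def wf_tm_def)

text \<open>
  A chain state reading one of the symbols \<open>0, 1, 2\<close> rejects, so that \<open>M\<close> does not leave the region while it
  writes the word. The last row sends the head back to the first letter.
\<close>

definition chain_row :: "nat \<Rightarrow> nat \<Rightarrow> nat list" where
  "chain_row k l = code (replicate 9 0) @
     concat (replicate (S - 3) (replicate k one @ counter # two # code [l, 0]))"

text \<open>
  The computation of the code works on a queue by passes: a pass removes the first letter \<open>l\<close>
  and applies \<open>hom l\<close> to all others. The letters \<open>one\<close> and \<open>two\<close> belong to the table of the first \<open>N\<close>
  states, which grows in front of \<open>dollar\<close>; \<open>unit\<close> does not, but the word has \<open>N\<close> of them. Each of the
  three adds the row of a chain state behind \<open>dollar\<close>. A \<open>counter\<close> ends an unfinished unary number, which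
  every pass increments. The \<open>pending\<close> letters, one for each \<open>unit\<close>, cause \<open>N\<close> further
  increments at the end, after which \<open>hash\<close> starts the pass that removes the separators.
\<close>

definition hom :: "nat \<Rightarrow> nat \<Rightarrow> nat list" where
  "hom l a =
     (if a = counter then (if l = hash then [] else [one, counter])
      else if a = hash then (if l = unit then [pending, hash] else [hash])
      else if a = dollar then
        (if l = hash then [] else if l = pending then [dollar]
         else (if l = unit then [] else [l]) @ dollar # chain_row 1 l)
      else [a])"

text \<open>Control \<open>0\<close> is between two passes, control \<open>1\<close> is final, and control \<open>l\<close> is in the pass for \<open>l\<close>.\<close>

definition queue_trans :: "nat \<Rightarrow> nat \<Rightarrow> nat \<times> nat list" where
  "queue_trans c a =
     (if c = 0 then (a, [])
      else if a = fin then (if c = hash then (1, []) else (0, [fin]))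
      else (c, hom c a))"

text \<open>In \<open>[3, 3, 1]\<close> the first 3 is the number of the state \<open>Pop 0\<close>,
  the second is the symbol \<open>blank\<close>, and 1 encodes a move to the right.\<close>

definition last_row :: "nat list" where
  "last_row = code (replicate 9 0) @ code (concat (replicate (S - 3) [3, 3, 1]))"

text \<open>The shape of the queue between passes. Behind \<open>hash\<close> stands a code in
  progress: the unfinished number of states \<open>k\<close>, the other parameters, the part
  \<open>e\<close> of the control table recovered so far, and the chain rows as pairs of target
  state and letter.\<close>

definition queue_word :: "nat list \<Rightarrow> nat \<Rightarrow> nat list \<Rightarrow> (nat \<times> nat) list \<Rightarrow> nat list" where
  "queue_word ps k e rows =
     ps @ hash # replicate k one @ counter # two # code [1, S, 2, 1, 0] @ e @
     dollar # concat (map (\<lambda>(k, l). chain_row k l) rows) @ last_row"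

text \<open>The count starts at 1, for the last chain state. The passes for the \<open>K\<close>
  letters and the \<open>N\<close> pending letters raise it to \<open>N + K + 1\<close>.\<close>

definition const_word :: "nat list" where
  "const_word = queue_word [] 1 [] [] @ [fin]"

abbreviation reject :: "control \<times> nat \<times> move" where
  "reject \<equiv> (Rej, 0, MLeft)"

definition resume :: "nat \<Rightarrow> control" where
  "resume c = (if c = 1 then Sim (start D) else Pop c)"

text \<open>
  In \<open>Sweep f j\<close>, \<open>j\<close> marks have been erased since the last one kept, and \<open>f\<close> is \<open>1\<close> if some mark was kept
  in this sweep, and otherwise \<open>0\<close> in the first sweep and \<open>2\<close> later. In \<open>Push c b j\<close>, the letter \<open>b\<close> was
  popped and \<open>j\<close> letters have been pushed. \<open>Letter i\<close> is the \<open>i\<close>-th chain state; its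
  transitions are not given here but in \<open>mach\<close>.
\<close>

fun act :: "control \<Rightarrow> nat \<Rightarrow> control \<times> nat \<times> move" where
  "act Rej a = reject"
| "act Acc a = reject"
| "act (Sweep f j) a =
     (if a = 0 then
        (if f = 0 then reject else if f = 1 then (Return, 0, MLeft) else (Final, 0, MLeft))
      else if a = 1 then
        (if Suc j = B then (Sweep 1 0, 1, MRight) else (Sweep f (Suc j), 2, MRight))
      else if a = 2 then (Sweep f j, 2, MRight) else reject)"
| "act Return a =
     (if a = 0 then (Convert, origin, MRight) else if a < 3 then (Return, a, MLeft)
      else (Extend, a, MLeft))"
| "act Extend a = (if a = 0 then (Convert, blank, MRight) else (Extend, a, MLeft))"
| "act Convert a =
     (if a = 2 then (Sweep 2 0, blank, MRight) else if a < 3 then reject else (Convert, a, MRight))"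
| "act Final a =
     (if a = origin then (Write (length const_word - 1), blank, MLeft) else (Final, a, MLeft))"
| "act (Write j) a =
     (if a < 3 then reject
      else (if j = 0 then Letter 0 else Write (j - 1), const_word ! j, MLeft))"
| "act (Letter i) a = reject"
| "act (Pop c) a = (if a < 3 then reject else (Push c a 0, blank, MRight))"
| "act (Push c b j) a =
     (if a < 3 then reject else if a \<noteq> blank then (Push c b j, a, MRight)
      else if j < length (snd (queue_trans c b))
        then (Push c b (Suc j), snd (queue_trans c b) ! j, MRight)
      else (Back (fst (queue_trans c b)), blank, MLeft))"
| "act (Back c) a =
     (if a < 3 then reject else if a \<noteq> blank then (Back c, a, MLeft) else (resume c, blank, MRight))"
| "act (Sim q) a =
     (if a < 3 then reject else if q = acc D then (Loop, a, MRight) else if q = rej D then reject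
      else case delta D q (dec_sym a) of (q', b, m) \<Rightarrow> (Sim q', enc_sym b, m))"
| "act Loop a = (Loop, a, MRight)"

text \<open>\<open>Sweep 0 0\<close> and \<open>Pop 0\<close> occur again further on. Listing them
  early fixes their numbers as 2 and 3, to which \<open>mach\<close> and \<open>last_row\<close>
  refer.\<close>

definition controls :: "control list" where
  "controls = [Rej, Acc, Sweep 0 0, Pop 0, Return, Extend, Convert, Final, Loop] @
     concat (map (\<lambda>f. map (Sweep f) [0..<B]) [0..<3]) @
     map Write [0..<length const_word] @ map Pop [0..<S] @ map Back [0..<S] @
     concat (map (\<lambda>c. concat (map (\<lambda>a. map (Push c a) [0..<Suc (length (snd (queue_trans c a)))])
                                 [0..<S])) [0..<S]) @
     map Sim [0..<num_states D]"

definition N :: nat where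
  "N = length controls"

text \<open>The least index passes over the second copies in \<open>controls\<close>.\<close>

fun num :: "control \<Rightarrow> nat" where
  "num (Letter i) = N + i"
| "num s = (LEAST i. i < N \<and> controls ! i = s)"

declare num.simps(2-) [simp del]

definition control_delta :: "nat \<Rightarrow> nat \<Rightarrow> nat \<times> nat \<times> move" where
  "control_delta q a = (case act (controls ! q) a of (s, b, m) \<Rightarrow> (num s, b, m))"

text \<open>Depends on the chain only through \<open>N\<close>, the number of
  \<open>Letter 0\<close>, and not on the letters, so the letters can be defined from it without
  circularity.\<close>

definition control_table :: "nat list" where
  "control_table =
     concat (map (\<lambda>q. concat (map (\<lambda>a. case control_delta q a of (q', b, m) \<Rightarrow> [q', b, move_code m])
                                [0..<S])) [2..<N])"

text \<open>The units tell the queue computation the value of \<open>N\<close>. It could not be put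
  into \<open>const_word\<close>, whose length contributes to \<open>N\<close>.\<close>

definition letters :: "nat list" where
  "letters = code control_table @ replicate N unit"

definition K :: nat where
  "K = length letters"

text \<open>The chain moves left, so it writes the letters from the last to the first.\<close>

definition mach :: tm where
  "mach = \<lparr>num_states = N + K + 1, num_inputs = 1, num_symbols = S, start = 2, acc = 1, rej = 0,
     delta = (\<lambda>q a. if q < N then control_delta q a else if a < 3 then (0, 0, MLeft)
       else if q < N + K then (q + 1, letters ! (K - 1 - (q - N)), MLeft)
       else (3, blank, MRight))\<rparr>"

lemma mach_simps [simp]:
  "num_states mach = N + K + 1" "num_inputs mach = 1" "num_symbols mach = S"
  "start mach = 2" "acc mach = 1" "rej mach = 0"
  by (simp_all add: mach_def)

lemma halting_mach [simp]: "halting mach q \<longleftrightarrow> q < 2"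
  by (auto simp: halting_def)

section \<open>Numbering of the states, well-formedness and the transition table\<close>

lemma set_controls:
  "set controls = {Rej, Acc, Return, Extend, Convert, Final, Loop} \<union>
     {Sweep f j | f j. f < 3 \<and> j < B} \<union> {Write j | j. j < length const_word} \<union>
     {Pop c | c. c < S} \<union> {Back c | c. c < S} \<union>
     {Push c a j | c a j. c < S \<and> a < S \<and> j \<le> length (snd (queue_trans c a))} \<union>
     {Sim q | q. q < num_states D}"
proof -
  have 1: "set (concat (map (\<lambda>f. map (Sweep f) [0..<B]) [0..<3])) = {Sweep f j | f j. f < 3 \<and> j < B}"
    by auto
  have 2: "set (concat (map (\<lambda>c. concat (map (\<lambda>a. map (Push c a)
      [0..<Suc (length (snd (queue_trans c a)))]) [0..<S])) [0..<S])) =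
      {Push c a j | c a j. c < S \<and> a < S \<and> j \<le> length (snd (queue_trans c a))}"
    by (auto simp: less_Suc_eq_le image_iff simp del: upt_Suc)
  have 3: "set (map f [0..<k]) = {f j | j. j < k}" for f :: "nat \<Rightarrow> control" and k
    by auto
  have 4: "set [Rej, Acc, Sweep 0 0, Pop 0, Return, Extend, Convert, Final, Loop] =
      {Rej, Acc, Return, Extend, Convert, Final, Loop} \<union> {Sweep 0 0} \<union> {Pop 0}"
    by auto
  have 5: "Sweep 0 0 \<in> {Sweep f j | f j. f < 3 \<and> j < B}" "Pop 0 \<in> {Pop c | c. c < S}"
    using two_le_B S_gt by auto
  show ?thesis
    unfolding controls_def set_append 1 2 3 4 using 5 by blast
qed

lemma in_controls [simp]:
  "Rej \<in> set controls" "Acc \<in> set controls" "Return \<in> set controls" "Extend \<in> set controls"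
  "Convert \<in> set controls" "Final \<in> set controls" "Loop \<in> set controls"
  "Sweep f j \<in> set controls \<longleftrightarrow> f < 3 \<and> j < B"
  "Write j \<in> set controls \<longleftrightarrow> j < length const_word"
  "Pop c \<in> set controls \<longleftrightarrow> c < S"
  "Back c \<in> set controls \<longleftrightarrow> c < S"
  "Push c a j \<in> set controls \<longleftrightarrow> c < S \<and> a < S \<and> j \<le> length (snd (queue_trans c a))"
  "Sim q \<in> set controls \<longleftrightarrow> q < num_states D"
  "Letter i \<notin> set controls"
  unfolding set_controls by simp_all

lemma controls_nth: "controls ! 0 = Rej" "controls ! 1 = Acc" "controls ! 2 = Sweep 0 0" "controls ! 3 = Pop 0"
  by (simp_all add: controls_def)

lemma N_ge: "4 \<le> N"
  by (simp add: N_def controls_def)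

lemma num_eq: "s \<in> set controls \<Longrightarrow> num s = (LEAST i. i < N \<and> controls ! i = s)"
  by (cases s) (simp_all add: num.simps)

lemma num_less:
  assumes "s \<in> set controls" shows "num s < N" and "controls ! num s = s"
proof -
  have "\<exists>i. i < N \<and> controls ! i = s" using assms by (auto simp: in_set_conv_nth N_def)
  from LeastI_ex[OF this] show "num s < N" "controls ! num s = s"
    by (simp_all add: num_eq[OF assms])
qed

lemma num_ge_2:
  assumes "s \<in> set controls" "s \<noteq> Rej" "s \<noteq> Acc"
  shows "2 \<le> num s"
proof (rule ccontr)
  assume "\<not> 2 \<le> num s"
  then have "num s = 0 \<or> num s = 1" by linarith
  then show False using num_less(2)[OF assms(1)] assms(2,3) controls_nth(1,2) by auto
qed

lemma num_le: "i < N \<Longrightarrow> controls ! i = s \<Longrightarrow> num s \<le> i"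
  using num_eq[of s] by (auto simp: N_def intro: Least_le)

lemma controls_initial: "Rej \<in> set controls" "Sweep 0 0 \<in> set controls" "Pop 0 \<in> set controls"
  using S_gt two_le_B by simp_all

lemma num_simps [simp]: "num Rej = 0" "num (Sweep 0 0) = 2" "num (Pop 0) = 3"
proof -
  show "num Rej = 0" using num_le[of 0] controls_nth N_ge by fastforce
  show "num (Sweep 0 0) = 2" using num_le[of 2] controls_nth N_ge num_ge_2[OF controls_initial(2)] by force
  have "num (Pop 0) \<noteq> 2" using num_less(2)[OF controls_initial(3)] controls_nth(3) by force
  then show "num (Pop 0) = 3" using num_le[of 3] controls_nth N_ge num_ge_2[OF controls_initial(3)] by force
qed

lemma K_ge: "N \<le> K"
  by (simp add: K_def letters_def)

lemma set_chain_row: "set (chain_row k l) \<subseteq> {counter, one, two}"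
  using set_code[of "replicate 9 0"] by (auto simp: chain_row_def set_replicate_conv_if split: if_splits)

lemma set_last_row: "set last_row \<subseteq> {one, two}"
  using set_code unfolding last_row_def by auto

lemma set_hom: "set (hom l a) \<subseteq> {pending, hash, dollar, counter, one, two, l, a}"
  using set_chain_row[of 1 l] by (auto simp: hom_def split: if_splits)

lemma queue_trans_less:
  assumes "c < S" "a < S"
  shows "fst (queue_trans c a) < S" "b \<in> set (snd (queue_trans c a)) \<Longrightarrow> b < S"
proof -
  show "fst (queue_trans c a) < S"
    using assms by (auto simp: queue_trans_def)
  have "set (hom c a) \<subseteq> {..<S}" using set_hom[of c a] assms S_gt by auto
  then show "b \<in> set (snd (queue_trans c a)) \<Longrightarrow> b < S"
    using S_gt by (auto simp: queue_trans_def split: if_splits)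
qed

lemma set_const_word: "set const_word \<subseteq> {hash, dollar, counter, fin, one, two}"
  using set_last_row by (auto simp: const_word_def queue_word_def)

lemma const_word_ne: "const_word \<noteq> []"
  by (simp add: const_word_def)

lemma set_letters: "set letters \<subseteq> {one, two, unit}"
  using set_code by (auto simp: letters_def)

lemma D_start: "start D < num_states D"
  using wf_D by (simp add: wf_tm_def)

lemma delta_D:
  assumes "q < num_states D" "\<not> halting D q" "a < num_symbols D" "delta D q a = (q', b, mv)"
  shows "q' < num_states D" "b < num_symbols D"
  using wf_D assms unfolding wf_tm_def by fastforce+

lemma resume_in: "c < S \<Longrightarrow> resume c \<in> set controls"
  using D_start by (simp add: resume_def)

lemma act_wf:
  assumes "s \<in> set controls" "a < S" "act s a = (s', b, mv)"
  shows "(s' \<in> set controls \<or> s' = Letter 0) \<and> b < S"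
proof (cases s)
  case (Sweep f j)
  define C where "C = set controls"
  have "Rej \<in> C" "Return \<in> C" "Final \<in> C" "\<forall>f < 3. \<forall>j < B. Sweep f j \<in> C" "Sweep 1 0 \<in> C"
    using two_le_B by (simp_all add: C_def)
  moreover have "f < 3" "j < B" using Sweep assms(1) by simp_all
  ultimately show ?thesis using Sweep assms(2,3) S_gt unfolding C_def[symmetric]
    by (auto split: if_splits)
next
  case (Write j)
  then have "const_word ! j \<in> set const_word" using assms by simp
  then have "const_word ! j < S" using set_const_word S_gt by auto
  then show ?thesis using Write assms S_gt by (auto split: if_splits)
next
  case (Push c a' j)
  then show ?thesis using assms S_gt queue_trans_less[of c a']
    by (auto split: if_splits)
next
  case (Back c)
  then show ?thesis using assms S_gt resume_in[of c] by (auto split: if_splits)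
next
  case (Sim q)
  show ?thesis
  proof (cases "a < 3 \<or> halting D q")
    case True
    then show ?thesis using Sim assms S_gt by (auto simp: halting_def split: if_splits)
  next
    case False
    obtain q1 b1 m1 where d: "delta D q (dec_sym a) = (q1, b1, m1)" by (cases "delta D q (dec_sym a)")
    have "dec_sym a < num_symbols D" using assms(2) wf_D by (auto simp: dec_sym_def S_def wf_tm_def)
    with delta_D[OF _ _ _ d] have "q1 < num_states D" "b1 < num_symbols D"
      using False Sim assms(1) by auto
    then show ?thesis
      using Sim assms(3) False d by (auto simp: halting_def S_def enc_sym_def)
  qed
next
  case Final
  then show ?thesis using assms S_gt const_word_ne by (auto split: if_splits)
qed (use assms S_gt two_le_B in \<open>auto split: if_splits\<close>)

lemma num_wf: "s \<in> set controls \<or> s = Letter 0 \<Longrightarrow> num s < N + K + 1"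
  using num_less(1)[of s] by auto

lemma delta_wf:
  assumes "q < N + K + 1" "a < S" "delta mach q a = (q', b, mv)"
  shows "q' < N + K + 1 \<and> b < S"
proof (cases "q < N")
  case True
  obtain s' where act: "act (controls ! q) a = (s', b, mv)" and q': "q' = num s'"
    using assms(3) True by (auto simp: mach_def control_delta_def split: prod.splits)
  have "controls ! q \<in> set controls" using True by (simp add: N_def)
  from act_wf[OF this assms(2) act] show ?thesis using num_wf q' by auto
next
  case False
  then have "letters ! (K - 1 - (q - N)) < S" if "q < N + K"
  proof -
    have "letters ! (K - 1 - (q - N)) \<in> set letters" using that False by (auto simp: K_def)
    then show ?thesis using set_letters S_gt by auto
  qed
  then show ?thesis using False assms N_ge S_gt by (auto simp: mach_def split: if_splits)
qed

lemma wf_mach: "wf_tm mach"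
  unfolding wf_tm_def mach_simps
proof (intro conjI allI impI)
  fix q a
  assume "q < N + K + 1" "a < S"
  then show "case delta mach q a of (q', b, mv) \<Rightarrow> q' < N + K + 1 \<and> b < S"
    using delta_wf[of q a] by (cases "delta mach q a") auto
qed (use N_ge S_gt in auto)

lemma delta_num:
  assumes "s \<in> set controls"
  shows "delta mach (num s) a = (case act s a of (s', b, mv) \<Rightarrow> (num s', b, mv))"
  using num_less[OF assms] by (simp add: mach_def control_delta_def)

lemma step_right:
  assumes "s \<in> set controls" "s \<noteq> Rej" "s \<noteq> Acc" "act s a = (s', b, MRight)"
  shows "step mach (conf z p (num s) l (a # r)) = conf z (p + 1) (num s') (b # l) r"
  using num_ge_2[OF assms(1-3)] assms(4) by (intro step_conf_right) (auto simp: delta_num[OF assms(1)])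

lemma step_left:
  assumes "s \<in> set controls" "s \<noteq> Rej" "s \<noteq> Acc" "act s a = (s', b, MLeft)"
  shows "step mach (conf z p (num s) (c # l) (a # r)) = conf z (p - 1) (num s') l (c # b # r)"
  using num_ge_2[OF assms(1-3)] assms(4) by (intro step_conf_left) (auto simp: delta_num[OF assms(1)])

lemma concat_map_const: "concat (map (\<lambda>a. c) xs) = concat (replicate (length xs) c)"
  by (induction xs) auto

lemma code_concat_replicate: "code (concat (replicate k xs)) = concat (replicate k (code xs))"
  by (induction k) auto

lemma row_split:
  assumes "\<And>a. a < 3 \<Longrightarrow> f a = c" "\<And>a. 3 \<le> a \<Longrightarrow> f a = d"
  shows "concat (map f [0..<S]) = c @ c @ c @ concat (replicate (S - 3) d)"
proof -
  have "[0..<S] = [0, 1, 2] @ [3..<S]"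
  proof -
    have "[0..<S] = [0..<3] @ [3..<S]" using S_gt upt_add_eq_append[of 0 3 "S - 3"] by simp
    moreover have "[0..<3] = [0, 1, 2 :: nat]" by (simp add: numeral_3_eq_3 numeral_2_eq_2)
    ultimately show ?thesis by simp
  qed
  moreover have "concat (map f [3..<S]) = concat (map (\<lambda>a. d) [3..<S])"
    by (rule arg_cong[where f = concat], rule map_cong) (auto simp: assms)
  ultimately show ?thesis by (simp add: assms concat_map_const)
qed

text \<open>Behind the control table everything is determined by \<open>N\<close>, \<open>S\<close>
  and the letters, which is what the machine can reconstruct.\<close>

lemma table_mach:
  "table mach = control_table @
     concat (map (\<lambda>i. replicate 9 0 @ concat (replicate (S - 3) [N + i + 1, letters ! (K - 1 - i), 0])) [0..<K]) @
     replicate 9 0 @ concat (replicate (S - 3) [3, 3, 1])"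
proof -
  define row where "row q = concat (map (\<lambda>a. case delta mach q a of (q', b, m) \<Rightarrow> [q', b, move_code m]) [0..<S])" for q
  have filter: "filter (\<lambda>q. \<not> halting mach q) [0..<num_states mach] = [2..<N] @ [N..<N + K] @ [N + K]"
  proof -
    have "[0..<num_states mach] = [0, 1] @ [2..<N] @ [N..<N + K] @ [N + K]"
    proof -
      have "[0..<N] = [0..<2] @ [2..<N]" using N_ge upt_add_eq_append[of 0 2 "N - 2"]
        by (simp del: upt_Suc add_2_eq_Suc add_2_eq_Suc')
      moreover have "[0..<2] = [0, 1 :: nat]" by (simp add: numeral_2_eq_2)
      moreover have "[0..<N + K] = [0..<N] @ [N..<N + K]" using upt_add_eq_append[of 0 N K] by simp
      ultimately show ?thesis by simp
    qed
    then show ?thesis using N_ge by (simp add: filter_id_conv)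
  qed
  have "table mach = concat (map row ([2..<N] @ [N..<N + K] @ [N + K]))"
    unfolding table_def filter unfolding row_def mach_simps by (rule refl)
  moreover have "concat (map row [2..<N]) = control_table"
    unfolding control_table_def row_def by (rule arg_cong[where f = concat], rule map_cong) (auto simp: mach_def)
  moreover have "map row [N..<N + K] =
      map (\<lambda>i. replicate 9 0 @ concat (replicate (S - 3) [N + i + 1, letters ! (K - 1 - i), 0])) [0..<K]"
  proof (rule nth_equalityI)
    fix i
    assume "i < length (map row [N..<N + K])"
    then have i: "i < K" by simp
    have "row (N + i) = replicate 9 0 @ concat (replicate (S - 3) [N + i + 1, letters ! (K - 1 - i), 0])"
    proof -
      have "row (N + i) = [0,0,0] @ [0,0,0] @ [0,0,0] @ concat (replicate (S - 3) [N + i + 1, letters ! (K - 1 - i), 0])"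
        unfolding row_def using i by (intro row_split) (auto simp: mach_def)
      then show ?thesis by (simp add: numeral_eq_Suc)
    qed
    then show "map row [N..<N + K] ! i = map (\<lambda>i. replicate 9 0 @
        concat (replicate (S - 3) [N + i + 1, letters ! (K - 1 - i), 0])) [0..<K] ! i"
      using i by simp
  qed simp
  moreover have "row (N + K) = replicate 9 0 @ concat (replicate (S - 3) [3, 3, 1])"
  proof -
    have "row (N + K) = [0,0,0] @ [0,0,0] @ [0,0,0] @ concat (replicate (S - 3) [3, 3, 1])"
      unfolding row_def by (intro row_split) (auto simp: mach_def)
    then show ?thesis by (simp add: numeral_eq_Suc)
  qed
  ultimately show ?thesis by (simp only: map_append concat_append list.map concat.simps append_Nil2)
qed

section \<open>Queue computations\<close>

lemma scan_right_control:
  assumes "s \<in> set controls" "s \<noteq> Rej" "s \<noteq> Acc" "\<And>a. a \<in> set u \<Longrightarrow> act s a = (s, a, MRight)"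
  shows "steps mach (length u) (conf z p (num s) l (u @ r))
           (conf z (p + int (length u)) (num s) (rev u @ l) r)"
  using num_ge_2[OF assms(1-3)] assms(4) by (intro scan_right) (auto simp: delta_num[OF assms(1)])

lemma scan_left_control:
  assumes "s \<in> set controls" "s \<noteq> Rej" "s \<noteq> Acc"
    and "\<And>b. b \<in> set (a # u) \<Longrightarrow> act s b = (s, b, MLeft)"
  shows "steps mach (Suc (length u)) (conf z p (num s) (u @ c # l) (a # r))
           (conf z (p - 1 - int (length u)) (num s) l (c # rev u @ a # r))"
  using num_ge_2[OF assms(1-3)] assms(4) by (intro scan_left) (auto simp: delta_num[OF assms(1)])

lemma push_word:
  assumes "c < S" "b < S" and u: "u = snd (queue_trans c b)" and "j \<le> length u"
  shows "reach mach (conf blank p (num (Push c b j)) l [])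
           (conf blank (p + int (length u - j)) (num (Push c b (length u))) (rev (drop j u) @ l) [])"
  using assms(4)
proof (induction "length u - j" arbitrary: j p l)
  case 0
  then show ?case by (simp add: reach_refl)
next
  case (Suc k)
  then have j: "j < length u" by simp
  have "step mach (conf blank p (num (Push c b j)) l [blank]) =
      conf blank (p + 1) (num (Push c b (Suc j))) (u ! j # l) []"
    using assms(1,2) j u by (intro step_right) auto
  then have 1: "reach mach (conf blank p (num (Push c b j)) l [])
      (conf blank (p + 1) (num (Push c b (Suc j))) (u ! j # l) [])"
    unfolding conf_Nil_right[of _ _ _ l] by (rule reach_step)
  have 2: "reach mach (conf blank (p + 1) (num (Push c b (Suc j))) (u ! j # l) [])
     (conf blank (p + 1 + int (length u - Suc j)) (num (Push c b (length u)))
        (rev (drop (Suc j) u) @ u ! j # l) [])"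
    using Suc by (intro Suc.hyps(1)) auto
  have 3: "p + 1 + int (length u - Suc j) = p + int (length u - j)"
    using j by (simp add: of_nat_diff)
  have 4: "rev (drop (Suc j) u) @ u ! j # l = rev (drop j u) @ l"
    unfolding Cons_nth_drop_Suc[OF j, symmetric] by simp
  show ?case using reach_trans[OF 1 2] unfolding 3 4 .
qed

text \<open>The first letter is erased, the head runs to the right end, appends \<open>u\<close> and
  returns. The queue contains no blank, so the blanks around it delimit it.\<close>

lemma queue_step:
  assumes "c < S" "3 \<le> a" "a < S" "queue_trans c a = (c', u)" "\<forall>b \<in> set (w @ u). 3 < b" "w @ u \<noteq> []"
  shows "reach mach (conf blank p (num (Pop c)) [] (a # w))
           (conf blank (p + 1) (num (resume c')) [] (w @ u))"
proof -
  define q where "q = p + 1 + int (length w) + int (length u)"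
  have c': "c' < S" using queue_trans_less(1)[OF assms(1,3)] assms(4) by simp
  have 1: "reach mach (conf blank p (num (Pop c)) [] (a # w))
      (conf blank (p + 1) (num (Push c a 0)) [blank] w)"
    using assms(1-3) by (intro reach_step step_right) simp_all
  have 2: "reach mach (conf blank (p + 1) (num (Push c a 0)) [blank] (w @ []))
      (conf blank (p + 1 + int (length w)) (num (Push c a 0)) (rev w @ [blank]) [])"
  proof (rule reachI[OF scan_right_control])
    fix b
    assume "b \<in> set w"
    then have "3 < b" using assms(5) by simp
    then show "act (Push c a 0) b = (Push c a 0, b, MRight)" by simp
  qed (use assms(1,3) in simp_all)
  have 3: "reach mach (conf blank (p + 1 + int (length w)) (num (Push c a 0)) (rev w @ [blank]) [])
     (conf blank q (num (Push c a (length u))) (rev u @ rev w @ [blank]) [])"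
    using push_word[OF assms(1,3), of u 0] assms(4) by (simp add: q_def)
  obtain d v where v: "w @ u = rev v @ [d]"
    using assms(6) by (metis rev_exhaust rev_rev_ident)
  have rv: "rev u @ rev w @ [blank] = d # v @ [blank]" using arg_cong[OF v, of rev] by simp
  have dv: "set (d # v) = set (w @ u)" using arg_cong[OF v, of set] by auto
  have 4: "reach mach (conf blank q (num (Push c a (length u))) (d # v @ [blank]) [])
      (conf blank (q - 1) (num (Back c')) (v @ [blank]) [d, blank])"
    unfolding conf_Nil_right[of _ _ _ "d # v @ [blank]"]
    using assms(1,3,4) by (intro reach_step step_left) simp_all
  have "3 < b" if "b \<in> set (d # v)" for b using that assms(5) unfolding dv by blast
  then have 5: "reach mach (conf blank (q - 1) (num (Back c')) (v @ [blank]) [d, blank])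
      (conf blank (q - 1 - 1 - int (length v)) (num (Back c')) [] (blank # rev v @ [d, blank]))"
    using c' by (intro reachI[OF scan_left_control]) fastforce+
  have 6: "q - 1 - 1 - int (length v) = p"
    using arg_cong[OF v, of length] by (simp add: q_def)
  have 7: "reach mach (conf blank p (num (Back c')) [] (blank # rev v @ [d, blank]))
      (conf blank (p + 1) (num (resume c')) [blank] (rev v @ [d, blank]))"
    using c' by (intro reach_step step_right) simp_all
  have "zip_tape blank (p + 1) [blank] ((w @ u) @ [blank]) = zip_tape blank (p + 1) [] (w @ u)"
    by (auto simp: zip_tape_def fun_eq_iff nth_append nth_Cons split: nat.splits)
  then have 8: "conf blank (p + 1) (num (resume c')) [blank] (rev v @ [d, blank]) =
      conf blank (p + 1) (num (resume c')) [] (w @ u)"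
    by (simp add: conf_def v)
  note 2 [simplified]
  note reach_trans[OF 1 this]
  note reach_trans[OF this 3]
  note reach_trans[OF this [unfolded rv] 4]
  note reach_trans[OF this 5]
  note reach_trans[OF this [unfolded 6] 7]
  then show ?thesis unfolding 8 .
qed

text \<open>Positions are quantified because every step moves the queue one cell to the
  right.\<close>

definition queue_reach :: "nat \<Rightarrow> nat list \<Rightarrow> nat \<Rightarrow> nat list \<Rightarrow> bool" where
  "queue_reach c w c' w' \<longleftrightarrow>
     (\<forall>p. \<exists>p'. reach mach (conf blank p (num (resume c)) [] w) (conf blank p' (num (resume c')) [] w'))"

lemma queue_reach_refl: "queue_reach c w c w"
  unfolding queue_reach_def using reach_refl by blast

lemma queue_reach_trans:
  "queue_reach c w c' w' \<Longrightarrow> queue_reach c' w' c'' w'' \<Longrightarrow> queue_reach c w c'' w''"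
  unfolding queue_reach_def by (meson reach_trans)

lemma queue_reach_step:
  assumes "c < S" "c \<noteq> 1" "queue_trans c a = (c', u)" "set (a # w) \<subseteq> {3<..<S}" "set u \<subseteq> {3<..}"
    "w @ u \<noteq> []"
  shows "queue_reach c (a # w) c' (w @ u)"
  unfolding queue_reach_def using queue_step[of c a c' u w] assms by (fastforce simp: resume_def)

abbreviation symbols :: "nat set" where
  "symbols \<equiv> {3<..<S}"

lemma hom_symbols: "l \<in> symbols \<Longrightarrow> a \<in> symbols \<Longrightarrow> set (hom l a) \<subseteq> symbols"
  using set_hom[of l a] S_gt by auto

text \<open>\<open>fin\<close> separates the letters still to be processed from the images already
  appended.\<close>

lemma queue_pass_partial:
  assumes "l \<in> symbols" "set v \<subseteq> symbols - {fin}" "set w \<subseteq> symbols"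
  shows "queue_reach l (v @ fin # w) l (fin # w @ concat (map (hom l) v))"
  using assms(2,3)
proof (induction v arbitrary: w)
  case (Cons a v)
  have "queue_reach l (a # v @ fin # w) l ((v @ fin # w) @ hom l a)"
    using Cons.prems assms(1) hom_symbols[of l a] S_gt
    by (intro queue_reach_step) (auto simp: queue_trans_def)
  moreover have "queue_reach l (v @ fin # (w @ hom l a)) l (fin # (w @ hom l a) @ concat (map (hom l) v))"
    using Cons.prems assms(1) hom_symbols[of l a] by (intro Cons.IH) auto
  ultimately show ?case using queue_reach_trans by fastforce
qed (simp add: queue_reach_refl)

lemma queue_pass_start:
  assumes "l \<in> symbols" "set w \<subseteq> symbols - {fin}"
  shows "queue_reach 0 (l # w @ [fin]) l (fin # concat (map (hom l) w))"
proof -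
  have "queue_reach 0 (l # w @ [fin]) l ((w @ [fin]) @ [])"
    using assms S_gt by (intro queue_reach_step) (auto simp: queue_trans_def)
  then show ?thesis using queue_pass_partial[OF assms, of "[]"] queue_reach_trans by fastforce
qed

lemma concat_hom_symbols:
  "l \<in> symbols \<Longrightarrow> set w \<subseteq> symbols \<Longrightarrow> set (concat (map (hom l) w)) \<subseteq> symbols"
  using hom_symbols by fastforce

lemma queue_pass:
  assumes "l \<in> symbols" "l \<noteq> hash" "set w \<subseteq> symbols - {fin}"
  shows "queue_reach 0 (l # w @ [fin]) 0 (concat (map (hom l) w) @ [fin])"
proof -
  have "queue_reach l (fin # concat (map (hom l) w)) 0 (concat (map (hom l) w) @ [fin])"
    using assms S_gt concat_hom_symbols[of l w]
    by (intro queue_reach_step) (auto simp: queue_trans_def)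
  then show ?thesis using queue_pass_start[OF assms(1,3)] queue_reach_trans by blast
qed

lemma queue_pass_final:
  assumes "set w \<subseteq> symbols - {fin}" "concat (map (hom hash) w) \<noteq> []"
  shows "queue_reach 0 (hash # w @ [fin]) 1 (concat (map (hom hash) w))"
proof -
  have "queue_reach hash (fin # concat (map (hom hash) w)) 1 (concat (map (hom hash) w) @ [])"
    using assms S_gt concat_hom_symbols[of hash w]
    by (intro queue_reach_step) (auto simp: queue_trans_def)
  then show ?thesis using queue_pass_start[of hash w] assms(1) S_gt queue_reach_trans by fastforce
qed

section \<open>Effect of a pass on the queue word\<close>

lemma hom_id: "set w \<subseteq> {unit, pending, one, two} \<Longrightarrow> concat (map (hom l) w) = w"
  by (induction w) (auto simp: hom_def)

lemma map_hom_code [simp]: "concat (map (hom l) (code ks)) = code ks"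
  using set_code by (intro hom_id) auto

lemma map_hom_replicate [simp]: "concat (map (hom l) (replicate k one)) = replicate k one"
  by (intro hom_id) auto

lemma hom_concat_replicate:
  "concat (map f (concat (replicate k xs))) = concat (replicate k (concat (map f xs)))"
  by (induction k) auto

lemma map_hom_chain_row:
  assumes "l' \<noteq> hash"
  shows "concat (map (hom l') (chain_row k l)) = chain_row (Suc k) l"
proof -
  have "concat (map (hom l') (replicate k one @ counter # two # code [l, 0])) =
      replicate (Suc k) one @ counter # two # code [l, 0]"
    using assms unfolding map_append list.map concat.simps concat_append map_hom_code map_hom_replicate
    by (simp add: hom_def replicate_app_Cons_same)
  then show ?thesis
    unfolding chain_row_def map_append concat_append map_hom_code hom_concat_replicate by metis
qed

lemma map_hom_hash_chain_row:
  "concat (map (hom hash) (chain_row k l)) = code (replicate 9 0 @ concat (replicate (S - 3) [k, l, 0]))"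
  unfolding chain_row_def map_append concat_append map_hom_code hom_concat_replicate code_concat_replicate
  by (simp add: hom_def code_concat_replicate)

lemma map_hom_last_row [simp]: "concat (map (hom l) last_row) = last_row"
  using set_last_row by (intro hom_id) auto

lemma map_hom_rows:
  assumes "l' \<noteq> hash"
  shows "concat (map (hom l') (concat (map (\<lambda>(k, l). chain_row k l) rows))) =
    concat (map (\<lambda>(k, l). chain_row k l) (map (\<lambda>(k, l). (Suc k, l)) rows))"
  by (induction rows) (auto simp: map_hom_chain_row[OF assms])

lemma map_hom_hash_rows:
  "concat (map (hom hash) (concat (map (\<lambda>(k, l). chain_row k l) rows))) =
    code (concat (map (\<lambda>(k, l). replicate 9 0 @ concat (replicate (S - 3) [k, l, 0])) rows))"
  by (induction rows) (auto simp: map_hom_hash_chain_row)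

lemma map_hom_queue_word:
  assumes "set ps \<subseteq> {one, two, unit, pending}" "set e \<subseteq> {one, two}" "l \<in> {one, two, unit}"
  shows "concat (map (hom l) (queue_word ps k e rows)) =
    queue_word (ps @ (if l = unit then [pending] else [])) (Suc k)
      (e @ (if l = unit then [] else [l])) ((1, l) # map (\<lambda>(k, l). (Suc k, l)) rows)"
proof -
  have "concat (map (hom l) ps) = ps" "concat (map (hom l) e) = e"
    using assms(1,2) by (auto intro!: hom_id)
  then show ?thesis using assms(3)
    unfolding queue_word_def map_append concat_append list.map concat.simps map_hom_code
      map_hom_last_row map_hom_replicate
    by (auto simp: map_hom_rows hom_def replicate_append_same simp flip: append_Cons)
qed

lemma map_hom_pending_queue_word:
  assumes "set ps \<subseteq> {one, two, unit, pending}" "set e \<subseteq> {one, two}"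
  shows "concat (map (hom pending) (queue_word ps k e rows)) =
    queue_word ps (Suc k) e (map (\<lambda>(k, l). (Suc k, l)) rows)"
proof -
  have "concat (map (hom pending) ps) = ps" "concat (map (hom pending) e) = e"
    using assms(1,2) by (auto intro!: hom_id)
  then show ?thesis
    unfolding queue_word_def map_append concat_append list.map concat.simps map_hom_code
      map_hom_last_row map_hom_replicate
    by (auto simp: map_hom_rows hom_def replicate_append_same simp flip: append_Cons)
qed

lemma set_queue_word:
  assumes "set ps \<subseteq> {one, two, unit, pending}" "set e \<subseteq> {one, two}"
  shows "set (queue_word ps k e rows) \<subseteq> symbols - {fin}"
proof -
  have "set (queue_word ps k e rows) \<subseteq> {one, two, unit, pending, hash, dollar, counter}"
    using assms set_chain_row set_last_row unfolding queue_word_def by fastforce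
  then show ?thesis using S_gt by auto
qed

section \<open>The machine obtains its own code\<close>

definition bump :: "nat \<Rightarrow> (nat \<times> nat) list \<Rightarrow> (nat \<times> nat) list" where
  "bump n rows = map (\<lambda>(k, l). (k + n, l)) rows"

lemma bump_simps [simp]: "bump 0 rows = rows" "bump n (bump n' rows) = bump (n + n') rows"
  "bump n ((k, l) # rows) = (k + n, l) # bump n rows"
  by (auto simp: bump_def map_idI)

lemma bump_1: "map (\<lambda>(k, l). (Suc k, l)) rows = bump 1 rows"
  by (simp add: bump_def)

lemma bump_enumerate: "bump n (enumerate k xs) = enumerate (k + n) xs"
  by (induction xs arbitrary: k) (auto simp: bump_def)

lemma queue_word_Cons: "queue_word (p # ps) k e rows = p # queue_word ps k e rows"
  by (simp add: queue_word_def)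

text \<open>A row enters with target 1 and gains 1 in each later pass, so the last letter has the
  smallest target. This is the order of the chain, which writes from right to left.\<close>

lemma process_letters:
  assumes "set ys \<subseteq> {one, two, unit}" "set ps \<subseteq> {pending}" "set e \<subseteq> {one, two}"
  shows "queue_reach 0 (queue_word (ys @ ps) k e rows @ [fin])
     0 (queue_word (ps @ replicate (count_list ys unit) pending) (k + length ys)
          (e @ filter (\<lambda>y. y \<noteq> unit) ys) (enumerate 1 (rev ys) @ bump (length ys) rows) @ [fin])"
  using assms
proof (induction ys arbitrary: ps k e rows)
  case Nil
  then show ?case by (simp add: queue_reach_refl)
next
  case (Cons y ys)
  have "set (queue_word (ys @ ps) k e rows) \<subseteq> symbols - {fin}"
    using Cons.prems by (intro set_queue_word) auto
  then have "queue_reach 0 (y # queue_word (ys @ ps) k e rows @ [fin])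
      0 (concat (map (hom y) (queue_word (ys @ ps) k e rows)) @ [fin])"
    using Cons.prems S_gt by (intro queue_pass) auto
  moreover have "concat (map (hom y) (queue_word (ys @ ps) k e rows)) =
      queue_word ((ys @ ps) @ (if y = unit then [pending] else [])) (Suc k)
        (e @ (if y = unit then [] else [y])) ((1, y) # map (\<lambda>(k, l). (Suc k, l)) rows)"
    using Cons.prems by (intro map_hom_queue_word) auto
  ultimately have 1: "queue_reach 0 (queue_word ((y # ys) @ ps) k e rows @ [fin])
      0 (queue_word (ys @ (ps @ (if y = unit then [pending] else []))) (Suc k)
        (e @ (if y = unit then [] else [y])) ((1, y) # bump 1 rows) @ [fin])"
    by (simp add: queue_word_Cons bump_1)
  have 2: "queue_reach 0 (queue_word (ys @ (ps @ (if y = unit then [pending] else []))) (Suc k)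
        (e @ (if y = unit then [] else [y])) ((1, y) # bump 1 rows) @ [fin])
     0 (queue_word ((ps @ (if y = unit then [pending] else [])) @ replicate (count_list ys unit) pending)
          (Suc k + length ys)
          ((e @ (if y = unit then [] else [y])) @ filter (\<lambda>y. y \<noteq> unit) ys)
          (enumerate 1 (rev ys) @ bump (length ys) ((1, y) # bump 1 rows)) @ [fin])"
    using Cons.prems by (intro Cons.IH) auto
  have 3: "enumerate 1 (rev ys) @ bump (length ys) ((1, y) # bump 1 rows) =
      enumerate 1 (rev (y # ys)) @ bump (length (y # ys)) rows"
    by (simp add: enumerate_append_eq)
  show ?case using queue_reach_trans[OF 1 2] unfolding 3 by (simp split: if_splits)
qed

text \<open>With \<open>j = N\<close> these increments shift the chain targets past the control
  states.\<close>

lemma process_pending: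
  assumes "set e \<subseteq> {one, two}"
  shows "queue_reach 0 (queue_word (replicate j pending) k e rows @ [fin])
     0 (queue_word [] (k + j) e (bump j rows) @ [fin])"
proof (induction j arbitrary: k rows)
  case 0
  then show ?case by (simp add: queue_reach_refl)
next
  case (Suc j)
  have "set (queue_word (replicate j pending) k e rows) \<subseteq> symbols - {fin}"
    using assms by (intro set_queue_word) auto
  then have "queue_reach 0 (pending # queue_word (replicate j pending) k e rows @ [fin])
      0 (concat (map (hom pending) (queue_word (replicate j pending) k e rows)) @ [fin])"
    using S_gt by (intro queue_pass) auto
  moreover have "concat (map (hom pending) (queue_word (replicate j pending) k e rows)) =
      queue_word (replicate j pending) (Suc k) e (map (\<lambda>(k, l). (Suc k, l)) rows)"
    using assms by (intro map_hom_pending_queue_word) auto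
  ultimately have 1: "queue_reach 0 (queue_word (replicate (Suc j) pending) k e rows @ [fin])
      0 (queue_word (replicate j pending) (Suc k) e (bump 1 rows) @ [fin])"
    by (simp add: queue_word_Cons bump_1)
  show ?case using queue_reach_trans[OF 1 Suc.IH] by simp
qed

lemma process_final:
  assumes "set e \<subseteq> {one, two}"
  shows "queue_reach 0 (queue_word [] k e rows @ [fin])
     1 (code [k, 1, S, 2, 1, 0] @ e @
        code (concat (map (\<lambda>(k, l). replicate 9 0 @ concat (replicate (S - 3) [k, l, 0])) rows)) @ last_row)"
proof -
  obtain w where w: "queue_word [] k e rows = hash # w"
    and w': "w = replicate k one @ counter # two # code [1, S, 2, 1, 0] @ e @
       dollar # concat (map (\<lambda>(k, l). chain_row k l) rows) @ last_row"
    by (simp add: queue_word_def)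
  have "concat (map (hom hash) e) = e"
    using assms by (intro hom_id) auto
  then have hw: "concat (map (hom hash) w) = replicate k one @ two # code [1, S, 2, 1, 0] @ e @
      code (concat (map (\<lambda>(k, l). replicate 9 0 @ concat (replicate (S - 3) [k, l, 0])) rows)) @ last_row"
    unfolding w' map_append concat_append list.map concat.simps map_hom_code
      map_hom_last_row map_hom_replicate map_hom_hash_rows
    by (simp add: hom_def)
  have "set w \<subseteq> symbols - {fin}"
    using set_queue_word[of "[]" e k rows] assms unfolding w by simp
  then show ?thesis
    using queue_pass_final[of w] unfolding w hw by simp
qed

lemma code_description_mach:
  "code (description mach) = code [1 + K + N, 1, S, 2, 1, 0] @ code control_table @
     code (concat (map (\<lambda>(k, l). replicate 9 0 @ concat (replicate (S - 3) [k, l, 0]))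
       (enumerate (1 + N) (rev letters)))) @ last_row"
proof -
  have "enumerate (1 + N) (rev letters) = map (\<lambda>i. (N + i + 1, letters ! (K - 1 - i))) [0..<K]"
    by (rule nth_equalityI) (auto simp: nth_enumerate_eq K_def rev_nth)
  then have rows: "concat (map (\<lambda>(k, l). replicate 9 0 @ concat (replicate (S - 3) [k, l, 0]))
       (enumerate (1 + N) (rev letters))) =
     concat (map (\<lambda>i. replicate 9 0 @ concat (replicate (S - 3) [N + i + 1, letters ! (K - 1 - i), 0])) [0..<K])"
    by (simp add: o_def)
  have "N + K + 1 = 1 + K + N" by simp
  then show ?thesis
    unfolding description_def table_mach mach_simps rows code_simps(3) last_row_def
    by (metis append_assoc)
qed

lemma count_list_replicate: "count_list (replicate n x) y = (if x = y then n else 0)"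
  by (induction n) auto

text \<open>The quine: the word supplies the control table, its length gives \<open>K\<close>, its
  units give \<open>N\<close>, and its letters give the chain rows. Together these determine the
  code.\<close>

lemma process_queue: "queue_reach 0 (letters @ const_word) 1 (map enc_sym (encode mach))"
proof -
  have c: "unit \<notin> set (code control_table)" using set_code[of control_table] by auto
  have u: "count_list letters unit = N" "filter (\<lambda>y. y \<noteq> unit) letters = code control_table"
  proof -
    show "count_list letters unit = N"
      using c by (simp add: letters_def count_list_replicate count_list_0_iff)
    show "filter (\<lambda>y. y \<noteq> unit) letters = code control_table"
      using c by (auto simp: letters_def filter_id_conv)
  qed
  have 1: "queue_reach 0 (queue_word letters 1 [] [] @ [fin])
      0 (queue_word (replicate N pending) (1 + K) (code control_table) (enumerate 1 (rev letters)) @ [fin])"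
    using process_letters[OF set_letters, of "[]" "[]" 1 "[]"] unfolding u
    by (simp add: K_def bump_def)
  have 2: "queue_reach 0 (queue_word (replicate N pending) (1 + K) (code control_table) (enumerate 1 (rev letters)) @ [fin])
      0 (queue_word [] (1 + K + N) (code control_table) (enumerate (1 + N) (rev letters)) @ [fin])"
    using process_pending[OF set_code, of N "1 + K" control_table "enumerate 1 (rev letters)"] by (simp add: bump_enumerate)
  have 3: "queue_reach 0 (queue_word [] (1 + K + N) (code control_table) (enumerate (1 + N) (rev letters)) @ [fin])
      1 (map enc_sym (encode mach))"
    using process_final[OF set_code] unfolding map_encode code_description_mach .
  have "letters @ const_word = queue_word letters 1 [] [] @ [fin]"
    by (simp add: const_word_def queue_word_def)
  then show ?thesis using queue_reach_trans[OF queue_reach_trans[OF 1 2] 3] by metis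
qed

text \<open>The start of the unbounded run: the region is the whole tape. The head is at -2 because
  \<open>Final\<close> finds \<open>origin\<close> at -1 and steps left.\<close>

definition ideal :: config where
  "ideal = conf blank (-2) (num (Write (length const_word - 1))) [] []"

text \<open>The control states write \<open>const_word\<close> from its right end, then the chain
  writes \<open>letters\<close> in front of it.\<close>

lemma chain_phase:
  assumes "t \<le> length const_word + K"
  shows "steps mach t ideal (conf blank (-2 - int t)
     (if t < length const_word then num (Write (length const_word - 1 - t)) else N + (t - length const_word))
     [] (blank # drop (length const_word + K - t) (letters @ const_word)))"
  using assms
proof (induction t)
  case 0
  have "drop (length const_word + K) (letters @ const_word) = []" by (simp add: K_def)
  then show ?case using const_word_ne steps_0
    by (simp add: ideal_def conf_Nil_right[of _ _ _ "[]"])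
next
  case (Suc t)
  define W where "W = length const_word"
  define q where "q t = (if t < W then num (Write (W - 1 - t)) else N + (t - W))" for t
  define w where "w = letters @ const_word"
  have w: "length w = W + K" by (simp add: w_def W_def K_def)
  have drop: "drop (W + K - Suc t) w = w ! (W + K - Suc t) # drop (W + K - t) w"
    using Suc.prems w Cons_nth_drop_Suc[of "W + K - Suc t" w] by (simp add: W_def Suc_diff_Suc)
  have "step mach (conf blank p (q t) [blank] (blank # r)) =
      conf blank (p - 1) (q (Suc t)) [] (blank # w ! (W + K - Suc t) # r)" for p r
  proof (cases "t < W")
    case True
    have "w ! (W + K - Suc t) = const_word ! (W - 1 - t)"
    proof -
      have "W + K - Suc t = length letters + (W - 1 - t)" using True by (simp add: K_def)
      then show ?thesis by (simp only: w_def nth_append_length_plus)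
    qed
    then have "act (Write (W - 1 - t)) blank =
        (if Suc t < W then Write (W - 1 - Suc t) else Letter 0, w ! (W + K - Suc t), MLeft)"
      using True by auto
    moreover have "q (Suc t) = num (if Suc t < W then Write (W - 1 - Suc t) else Letter 0)"
      using True by (auto simp: q_def)
    ultimately show ?thesis using True unfolding q_def
      by (simp only: if_True) (rule step_left, auto simp: W_def)
  next
    case False
    then obtain i where t: "t = W + i" using le_Suc_ex not_less by metis
    then have i: "i < K" using Suc.prems by (simp add: W_def)
    have "w ! (W + K - Suc t) = letters ! (K - 1 - i)"
    proof -
      have "W + K - Suc t = K - 1 - i" "K - 1 - i < length letters" using i t by (auto simp: K_def)
      then show ?thesis by (simp add: w_def nth_append)
    qed
    then have "delta mach (q t) blank = (q (Suc t), w ! (W + K - Suc t), MLeft)"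
      using i t by (simp add: mach_def q_def)
    then show ?thesis using N_ge False by (intro step_conf_left) (auto simp: q_def)
  qed
  from this[of "-2 - int t" "drop (W + K - t) w"]
  have "step mach (conf blank (-2 - int t) (q t) [] (blank # drop (W + K - t) w)) =
      conf blank (-2 - int (Suc t)) (q (Suc t)) [] (blank # drop (W + K - Suc t) w)"
    unfolding conf_Nil_left[of _ "-2 - int t"] drop by (simp add: algebra_simps)
  moreover have "steps mach t ideal (conf blank (-2 - int t) (q t) [] (blank # drop (W + K - t) w))"
    using Suc.IH[OF Suc_leD[OF Suc.prems]] by (simp only: q_def w_def W_def)
  ultimately have "steps mach (Suc t) ideal
      (conf blank (-2 - int (Suc t)) (q (Suc t)) [] (blank # drop (W + K - Suc t) w))"
    using steps_add steps_1 by fastforce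
  then show ?case by (simp only: q_def w_def W_def)
qed

lemma ideal_reaches_sim:
  "\<exists>p. reach mach ideal (conf blank p (num (Sim (start D))) [] (map enc_sym (encode mach)))"
proof -
  define q where "q = -2 - int (length const_word + K)"
  have 1: "reach mach ideal (conf blank q (N + K) [] (blank # letters @ const_word))"
    using reachI[OF chain_phase[OF order_refl]] by (simp add: q_def)
  have "step mach (conf blank q (N + K) [] (blank # letters @ const_word)) =
     conf blank (q + 1) (num (Pop 0)) [blank] (letters @ const_word)"
  proof (rule step_conf_right)
    show "delta mach (N + K) blank = (num (Pop 0), blank, MRight)" by (simp add: mach_def)
  qed (use N_ge in simp)
  also have "\<dots> = conf blank (q + 1) (num (resume 0)) [] (letters @ const_word)"
    using conf_Nil_left by (simp add: resume_def)
  finally have 2: "reach mach (conf blank q (N + K) [] (blank # letters @ const_word)) \<dots>"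
    by (rule reach_step)
  obtain p where "reach mach (conf blank (q + 1) (num (resume 0)) [] (letters @ const_word))
      (conf blank p (num (resume 1)) [] (map enc_sym (encode mach)))"
    using process_queue unfolding queue_reach_def by blast
  then show ?thesis using reach_trans[OF reach_trans[OF 1 2]] by (auto simp: resume_def)
qed

section \<open>Simulation of the decider\<close>

definition sim_config :: "int \<Rightarrow> config \<Rightarrow> config" where
  "sim_config p c = \<lparr>state = num (Sim (state c)), head = head c + p, tape = (\<lambda>i. enc_sym (tape c (i - p)))\<rparr>"

text \<open>The position to which the queue has drifted becomes the origin of the tape of
  \<open>D\<close>.\<close>

lemma sim_init: "conf blank p (num (Sim (start D))) [] (map enc_sym w) = sim_config p (init_config D w)"
  by (auto simp: conf_def sim_config_def init_config_def zip_tape_def fun_eq_iff enc_sym_def)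

lemma sim_step:
  assumes "state c < num_states D" "\<not> halting D (state c)"
  shows "step mach (sim_config p c) = sim_config p (step D c)"
proof -
  obtain q' b mv where d: "delta D (state c) (tape c (head c)) = (q', b, mv)"
    by (cases "delta D (state c) (tape c (head c))")
  have "delta mach (num (Sim (state c))) (enc_sym (tape c (head c))) = (num (Sim q'), enc_sym b, mv)"
    using assms d enc_sym_ge[of "tape c (head c)"] by (simp add: delta_num halting_def)
  then show ?thesis
    using assms d num_ge_2[of "Sim (state c)"]
    by (auto simp: sim_config_def step_def fun_eq_iff split: move.splits)
qed

lemma encode_inputs: "set (encode M) \<subseteq> {1, 2}"
  by (auto simp: encode_def)

lemma wf_config_init: "wf_config D (init_config D (encode M))"
proof -
  have "encode M ! i \<in> {1, 2}" if "i < length (encode M)" for i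
    using encode_inputs that nth_mem by blast
  then have "encode M ! i < num_symbols D" if "i < length (encode M)" for i
    using that S_gt unfolding S_def by fastforce
  moreover have "0 < num_symbols D" using S_gt by (simp add: S_def)
  ultimately show ?thesis using D_start by (auto simp: wf_config_def init_config_def)
qed

lemma sim_reach:
  "reach mach (sim_config p (init_config D (encode M))) (sim_config p (run D (encode M) t))"
proof (induction t)
  case 0
  then show ?case by (simp add: run_def reach_refl)
next
  case (Suc t)
  have "wf_config D (run D (encode M) t)"
    unfolding run_def using wf_config_funpow[OF wf_D wf_config_init] .
  then have "reach mach (sim_config p (run D (encode M) t)) (sim_config p (run D (encode M) (Suc t)))"
    using sim_step[of "run D (encode M) t" p]
    by (cases "halting D (state (run D (encode M) t))")
      (auto simp: wf_config_def run_def step_def[of D] intro: reach_refl reach_step)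
  then show ?case using Suc reach_trans by blast
qed

lemma ideal_reaches_run: "\<exists>p. reach mach ideal (sim_config p (run D (encode mach) t))"
  using ideal_reaches_sim sim_reach reach_trans unfolding sim_init by blast

lemma ideal_halted_sim:
  assumes "state (run D (encode mach) t) = q" "q < num_states D" "\<And>a. 3 \<le> a \<Longrightarrow> fst (act (Sim q) a) = s"
  shows "\<exists>t. state ((step mach ^^ t) ideal) = num s"
proof -
  obtain p where p: "reach mach ideal (sim_config p (run D (encode mach) t))"
    using ideal_reaches_run by blast
  define c where "c = sim_config p (run D (encode mach) t)"
  have c: "state c = num (Sim q)" "3 \<le> tape c (head c)"
    using assms(1) enc_sym_ge by (simp_all add: c_def sim_config_def)
  have "\<not> halting mach (state c)" using c num_ge_2[of "Sim q"] assms(2) by simp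
  moreover obtain b mv where "act (Sim q) (tape c (head c)) = (s, b, mv)"
    using assms(3)[OF c(2)] by (metis prod.collapse)
  ultimately have "state (step mach c) = num s"
    using c(1) assms(2) by (simp add: step_def delta_num)
  moreover have "reach mach ideal (step mach c)"
    using reach_trans[OF p] reach_step c_def by blast
  ultimately show ?thesis unfolding reach_def steps_def by metis
qed

lemma ideal_accept:
  assumes "accepts D (encode mach)"
  shows "\<exists>t. state ((step mach ^^ t) ideal) = num Loop"
proof -
  obtain t where "state (run D (encode mach) t) = acc D"
    using assms by (auto simp: accepts_def)
  moreover have "acc D < num_states D" using wf_D by (simp add: wf_tm_def)
  ultimately show ?thesis by (rule ideal_halted_sim) simp
qed

lemma ideal_reject:
  assumes "rejects D (encode mach)"
  shows "\<exists>t. state ((step mach ^^ t) ideal) = 0"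
proof -
  obtain t where "state (run D (encode mach) t) = rej D"
    using assms by (auto simp: rejects_def)
  moreover have "rej D < num_states D" "rej D \<noteq> acc D" using wf_D by (auto simp: wf_tm_def)
  ultimately show ?thesis using ideal_halted_sim[of t "rej D" Rej] by simp
qed

section \<open>Sweeps\<close>

text \<open>What a sweep starting in \<open>Sweep f j\<close> leaves behind.\<close>

fun thin :: "nat \<Rightarrow> nat list \<Rightarrow> nat list" where
  "thin j [] = []"
| "thin j (a # u) =
     (if a = 1 then if Suc j = B then 1 # thin 0 u else 2 # thin (Suc j) u else 2 # thin j u)"

lemma length_thin [simp]: "length (thin j u) = length u"
  by (induction j u rule: thin.induct) auto

lemma set_thin: "set (thin j u) \<subseteq> {1, 2}"
  by (induction j u rule: thin.induct) auto

lemma count_thin: "j < B \<Longrightarrow> count_list (thin j u) 1 = (j + count_list u 1) div B"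
proof (induction j u rule: thin.induct)
  case (2 j a u)
  show ?case
  proof (cases "a = 1 \<and> Suc j = B")
    case True
    then have "j + count_list (a # u) 1 = B + count_list u 1" by simp
    then have "(j + count_list (a # u) 1) div B = Suc (count_list u 1 div B)"
      using two_le_B by (simp only: div_add_self1)
    then show ?thesis using True 2 two_le_B by simp
  qed (use 2 in auto)
qed simp

text \<open>As \<open>2 \<le> B\<close>, the first mark is never kept. The resulting 2 is the cell
  that \<open>Convert\<close> adds to the region on the right.\<close>

lemma hd_thin: "u \<noteq> [] \<Longrightarrow> \<exists>v. thin 0 u = 2 # v"
  using two_le_B by (cases u) auto

lemma sweep_right:
  assumes "j < B" "f < 3" "set u \<subseteq> {1, 2}"
  shows "\<exists>j' < B. steps mach (length u) (conf z p (num (Sweep f j)) l (u @ r))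
     (conf z (p + int (length u)) (num (Sweep (if 1 \<in> set (thin j u) then 1 else f) j'))
        (rev (thin j u) @ l) r)"
  using assms
proof (induction u arbitrary: j f p l)
  case Nil
  then show ?case by (auto intro: steps_0)
next
  case (Cons a u)
  obtain f' j' b where act: "act (Sweep f j) a = (Sweep f' j', b, MRight)"
    and thin: "thin j (a # u) = b # thin j' u" and j': "j' < B" and f': "f' = (if b = 1 then 1 else f)"
    using Cons.prems two_le_B by (cases "a = 1"; cases "Suc j = B") auto
  have step: "step mach (conf z p (num (Sweep f j)) l ((a # u) @ r)) =
      conf z (p + 1) (num (Sweep f' j')) (b # l) (u @ r)"
    using Cons.prems act by (simp del: act.simps add: step_right)
  have "f' < 3" using f' Cons.prems(2) by simp
  then obtain j'' where "j'' < B" and "steps mach (length u) (conf z (p + 1) (num (Sweep f' j')) (b # l) (u @ r))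
     (conf z (p + 1 + int (length u)) (num (Sweep (if 1 \<in> set (thin j' u) then 1 else f') j''))
        (rev (thin j' u) @ b # l) r)"
    using Cons.IH[of j' f' "p + 1" "b # l"] Cons.prems j' by auto
  moreover have "(if 1 \<in> set (thin j' u) then 1 else f') = (if 1 \<in> set (thin j (a # u)) then 1 else f)"
    using f' thin by auto
  ultimately show ?case using steps_Suc[OF step] thin
    by (intro exI[of _ j'']) (auto simp: algebra_simps)
qed

text \<open>The cells to the left of position \<open>a\<close> when the region is \<open>{-a..<a}\<close>, read leftwards.\<close>

definition region_word :: "nat \<Rightarrow> nat list" where
  "region_word a = replicate a blank @ (if a = 0 then [] else origin # replicate (a - 1) blank)"

text \<open>Sweeping and returning cross the marks twice. \<open>Extend\<close> and
  \<open>Convert\<close> then cross the region once each, adding one cell at its left and one at its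
  right end.\<close>

lemma sweep_round:
  assumes "set u \<subseteq> {1, 2}" "B \<le> count_list u 1"
  shows "steps mach (2 * length u + 4 * a + 3)
     (conf 0 (int a) (num (Sweep (if a = 0 then 0 else 2) 0)) (region_word a) u)
     (conf 0 (int (Suc a)) (num (Sweep 2 0)) (region_word (Suc a)) (tl (thin 0 u)))"
proof -
  define f :: nat where "f = (if a = 0 then 0 else 2)"
  define q where "q = int a + int (length u)"
  have "u \<noteq> []" using assms(2) two_le_B by auto
  then obtain v where v: "thin 0 u = 2 # v" using hd_thin by blast
  then have len: "length u = Suc (length v)" using length_thin[of 0 u] by simp
  have "count_list (thin 0 u) 1 \<noteq> 0"
    using count_thin[of 0 u] two_le_B assms(2) by (simp add: div_eq_0_iff)
  then have "1 \<in> set (thin 0 u)" using count_notin by fastforce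
  then obtain j where "j < B" and right: "steps mach (length u) (conf 0 (int a) (num (Sweep f 0)) (region_word a) u)
     (conf 0 q (num (Sweep 1 j)) (rev (thin 0 u) @ region_word a) [])"
  proof -
    have "f < 3" "0 < B" using two_le_B by (simp_all add: f_def)
    with \<open>1 \<in> set (thin 0 u)\<close> show thesis
      using that sweep_right[of 0 f u 0 "int a" "region_word a" "[]"] assms(1)
      by (auto simp: q_def simp del: One_nat_def)
  qed
  obtain x w where xw: "rev (thin 0 u) = x # w" using v by (cases "rev (thin 0 u)") auto
  have w: "length w = length v" using arg_cong[OF xw, of length] len by simp
  have xwset: "set (x # w) \<subseteq> {1, 2}" using set_thin[of 0 u] xw by (metis set_rev)
  have rxw: "rev w @ [x] = thin 0 u" using arg_cong[OF xw, of rev] by simp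
  have turn: "steps mach 1 (conf 0 q (num (Sweep 1 j)) (x # w @ region_word a) [0])
      (conf 0 (q - 1) (num Return) (w @ region_word a) [x, 0])"
    using \<open>j < B\<close> by (intro steps_1 step_left) auto
  have home: "steps mach (length u) (conf 0 (q - 1) (num Return) (w @ c # l) [x, 0])
      (conf 0 (int a - 1) (num Return) l (c # thin 0 u @ [0]))" for c l
  proof -
    have "steps mach (Suc (length w)) (conf 0 (q - 1) (num Return) (w @ c # l) (x # [0]))
       (conf 0 (q - 1 - 1 - int (length w)) (num Return) l (c # rev w @ x # [0]))"
    proof (rule scan_left_control)
      fix b
      assume "b \<in> set (x # w)"
      then have "b = 1 \<or> b = 2" using xwset by blast
      then show "act Return b = (Return, b, MLeft)" by auto
    qed simp_all
    moreover have "q - 1 - 1 - int (length w) = int a - 1" using w len by (simp add: q_def)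
    moreover have "rev w @ x # [0] = thin 0 u @ [0]" using rxw by simp
    moreover have "Suc (length w) = length u" using w len by simp
    ultimately show ?thesis by (simp only:)
  qed
  have right': "steps mach (length u) (conf 0 (int a) (num (Sweep f 0)) (region_word a) u)
     (conf 0 q (num (Sweep 1 j)) (x # w @ region_word a) [0])"
    using right unfolding xw conf_Nil_right[of _ q] by simp
  note there = steps_add[OF right' turn]
  have tl: "tl (thin 0 u) = v" by (simp add: v)
  show ?thesis
  proof (cases "a = 0")
    case True
    \<comment> \<open>There is no region yet: \<open>Return\<close> runs into the blank at -1 and
      puts \<open>origin\<close> there.\<close>
    have "conf 0 (q - 1) (num Return) (w @ region_word a) [x, 0] =
        conf 0 (q - 1) (num Return) (w @ 0 # []) [x, 0]"
      using True by (simp add: region_word_def conf_append_blank_left)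
    with there have 1: "steps mach (length u + 1) (conf 0 (int a) (num (Sweep f 0)) (region_word a) u)
        (conf 0 (q - 1) (num Return) (w @ 0 # []) [x, 0])" by simp
    have 2: "steps mach 1 (conf 0 (int a - 1) (num Return) [] (0 # thin 0 u @ [0]))
       (conf 0 (int a) (num Convert) [origin] (thin 0 u @ [0]))"
      using step_right[of Return 0 Convert origin 0 "int a - 1" "[]" "thin 0 u @ [0]"]
      by (intro steps_1) simp
    have "step mach (conf 0 (int a) (num Convert) [origin] (2 # v @ [0])) =
        conf 0 (int a + 1) (num (Sweep 2 0)) [blank, origin] (v @ [0])"
      by (intro step_right) auto
    then have 3: "steps mach 1 (conf 0 (int a) (num Convert) [origin] (thin 0 u @ [0]))
       (conf 0 (int (Suc a)) (num (Sweep 2 0)) (region_word (Suc a)) v)"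
      unfolding v using True by (intro steps_1) (simp add: region_word_def conf_append_blank_right)
    have "length u + 1 + length u + 1 + 1 = 2 * length u + 4 * a + 3" using True by simp
    then show ?thesis
      using steps_add[OF steps_add[OF steps_add[OF 1 home] 2] 3] unfolding tl f_def by metis
  next
    case False
    define l where "l = replicate (a - 1) blank @ origin # replicate (a - 1) blank"
    have reg: "region_word a = blank # l"
      using False by (cases a) (auto simp: region_word_def l_def)
    have len_l: "length l = 2 * a - 1" using False by (simp add: l_def)
    have rev_l: "rev l = l" by (simp add: l_def)
    have set_l: "set l \<subseteq> {blank, origin}" by (auto simp: l_def)
    obtain y l' where y: "l = y # l'" by (cases l) (auto simp: l_def)
    define r where "r = thin 0 u @ [0]"
    have 1: "steps mach 1 (conf 0 (int a - 1) (num Return) l (blank # r))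
       (conf 0 (int a - 1 - 1) (num Extend) l' (y # blank # r))"
      unfolding y by (intro steps_1 step_left) auto
    have "steps mach (Suc (length l')) (conf 0 (int a - 1 - 1) (num Extend) (l' @ 0 # []) (y # blank # r))
       (conf 0 (int a - 1 - 1 - 1 - int (length l')) (num Extend) [] (0 # rev l' @ y # blank # r))"
    proof (rule scan_left_control)
      fix b
      assume "b \<in> set (y # l')"
      then have "b \<noteq> 0" using set_l y by auto
      then show "act Extend b = (Extend, b, MLeft)" by simp
    qed simp_all
    moreover have "rev l' @ y # blank # r = l @ blank # r"
      using rev_l y by (metis append.assoc append_Cons append_Nil rev.simps(2))
    moreover have "int a - 1 - 1 - 1 - int (length l') = - int a - 1" "Suc (length l') = 2 * a - 1"
      using len_l y False by auto
    ultimately have 2: "steps mach (2 * a - 1) (conf 0 (int a - 1 - 1) (num Extend) l' (y # blank # r))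
       (conf 0 (- int a - 1) (num Extend) [] (0 # l @ blank # r))"
      by (simp only: conf_append_blank_left)
    have 3: "steps mach 1 (conf 0 (- int a - 1) (num Extend) [] (0 # l @ blank # r))
       (conf 0 (- int a) (num Convert) [blank] ((l @ [blank]) @ r))"
      using step_right[of Extend 0 Convert blank 0 "- int a - 1" "[]" "l @ blank # r"]
      by (intro steps_1) simp
    have "steps mach (length (l @ [blank])) (conf 0 (- int a) (num Convert) [blank] ((l @ [blank]) @ r))
       (conf 0 (- int a + int (length (l @ [blank]))) (num Convert) (rev (l @ [blank]) @ [blank]) r)"
      using set_l by (intro scan_right_control) auto
    moreover have "- int a + int (length (l @ [blank])) = int a" "length (l @ [blank]) = 2 * a"
      "rev (l @ [blank]) @ [blank] = blank # l @ [blank]"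
      using len_l rev_l False by auto
    ultimately have 4: "steps mach (2 * a) (conf 0 (- int a) (num Convert) [blank] ((l @ [blank]) @ r))
       (conf 0 (int a) (num Convert) (blank # l @ [blank]) r)"
      by (simp only:)
    have "step mach (conf 0 (int a) (num Convert) (blank # l @ [blank]) (2 # v @ [0])) =
        conf 0 (int a + 1) (num (Sweep 2 0)) (blank # blank # l @ [blank]) (v @ [0])"
      by (intro step_right) auto
    moreover have "region_word (Suc a) = blank # blank # l @ [blank]"
      using False by (cases a) (auto simp: region_word_def l_def replicate_append_same)
    ultimately have 5: "steps mach 1 (conf 0 (int a) (num Convert) (blank # l @ [blank]) r)
       (conf 0 (int (Suc a)) (num (Sweep 2 0)) (region_word (Suc a)) v)"
      unfolding r_def v by (intro steps_1) (simp add: conf_append_blank_right add.commute)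
    have "length u + 1 + length u + 1 + (2 * a - 1) + 1 + 2 * a + 1 = 2 * length u + 4 * a + 3"
      using False by simp
    moreover note steps_add[OF there home[of blank l, folded reg r_def]]
    moreover note steps_add[OF this 1]
    moreover note steps_add[OF this 2]
    moreover note steps_add[OF this 3]
    moreover note steps_add[OF this 4]
    moreover note steps_add[OF this 5]
    ultimately show ?thesis unfolding tl f_def by metis
  qed
qed

lemma replicate_init: "init_config mach (replicate n 1) = conf 0 0 (num (Sweep 0 0)) [] (replicate n 1)"
  by (auto simp: init_config_def conf_def zip_tape_def fun_eq_iff)

text \<open>Each round moves one input cell into the region, so \<open>r + length u\<close> stays
  \<open>n\<close> and a round costs at most \<open>4 * n + 3\<close> steps.\<close>

lemma sweep_rounds:
  assumes "B ^ r \<le> n"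
  shows "\<exists>t u. t \<le> r * (4 * n + 3) \<and> steps mach t (init_config mach (replicate n 1))
       (conf 0 (int r) (num (Sweep (if r = 0 then 0 else 2) 0)) (region_word r) u) \<and>
     set u \<subseteq> {1, 2} \<and> r + length u = n \<and> count_list u 1 = n div B ^ r"
  using assms
proof (induction r)
  case 0
  show ?case
    by (intro exI[of _ 0] exI[of _ "replicate n 1"])
      (auto simp: replicate_init region_word_def count_list_replicate steps_0 simp del: One_nat_def)
next
  case (Suc r)
  have "B ^ r \<le> B ^ Suc r" using two_le_B by simp
  then obtain t u where t: "t \<le> r * (4 * n + 3)" and st: "steps mach t (init_config mach (replicate n 1))
       (conf 0 (int r) (num (Sweep (if r = 0 then 0 else 2) 0)) (region_word r) u)"
    and u: "set u \<subseteq> {1, 2}" and len: "r + length u = n" and count: "count_list u 1 = n div B ^ r"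
    using Suc.IH[OF order_trans[OF _ Suc.prems]] by blast
  have "B \<le> n div B ^ r"
    using Suc.prems two_le_B by (simp add: less_eq_div_iff_mult_less_eq)
  then have B: "B \<le> count_list u 1" using count by simp
  have "steps mach (t + (2 * length u + 4 * r + 3)) (init_config mach (replicate n 1))
      (conf 0 (int (Suc r)) (num (Sweep (if Suc r = 0 then 0 else 2) 0)) (region_word (Suc r)) (tl (thin 0 u)))"
    using steps_add[OF st sweep_round[OF u B]] by simp
  moreover have "t + (2 * length u + 4 * r + 3) \<le> Suc r * (4 * n + 3)"
    using t len by simp
  moreover obtain v where v: "thin 0 u = 2 # v" using hd_thin[of u] B two_le_B by fastforce
  moreover have "set v \<subseteq> {1, 2}" using set_thin[of 0 u] v by simp
  moreover have "Suc r + length v = n" using len length_thin[of 0 u] unfolding v by simp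
  moreover have "count_list v 1 = n div B ^ Suc r"
    using count_thin[of 0 u] two_le_B count unfolding v by (simp add: div_mult2_eq power_Suc2 del: power_Suc)
  ultimately show ?case by (metis list.sel(3))
qed

text \<open>No mark survives the first sweep, so the machine rejects on the first blank after the
  input.\<close>

lemma short_input:
  assumes "n < B"
  shows "makes_at_most_steps mach (replicate n 1) (n + 1)"
proof -
  have "count_list (thin 0 (replicate n 1)) 1 = 0"
    using count_thin[of 0 "replicate n 1"] assms by (simp add: count_list_replicate)
  then have "1 \<notin> set (thin 0 (replicate n 1))" by (simp add: count_list_0_iff)
  moreover have "set (replicate n 1) \<subseteq> {1, 2 :: nat}" by auto
  ultimately obtain j where j: "j < B" and 1: "steps mach n (init_config mach (replicate n 1))
      (conf 0 (int n) (num (Sweep 0 j)) (rev (thin 0 (replicate n 1))) [0])"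
    using sweep_right[of 0 0 "replicate n 1" 0 0 "[]" "[]"] two_le_B
    unfolding replicate_init conf_Nil_right[of _ "int n", symmetric]
    by (auto simp del: One_nat_def num_simps)
  have "state (step mach (conf 0 (int n) (num (Sweep 0 j)) l [0])) = 0" for l
    using j num_ge_2[of "Sweep 0 j"] by (simp add: step_def delta_num zip_tape_def)
  then show ?thesis
    using steps_add[OF 1 steps_1[OF refl]]
    by (simp add: makes_at_most_steps_def run_def steps_def)
qed

text \<open>Inside the region this looks like \<open>ideal\<close>; outside are only symbols below
  3, which signal the boundary.\<close>

definition ready :: "nat \<Rightarrow> config \<Rightarrow> bool" where
  "ready r c \<longleftrightarrow> state c = state ideal \<and> head c = head ideal \<and>
     (\<forall>i. if - int r \<le> i \<and> i < int r then tape c i = blank else tape c i < 3)"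

text \<open>No mark survives, so the flag stays 2 and the head goes home to \<open>origin\<close>,
  which becomes an ordinary cell of the region.\<close>

lemma sweep_final:
  assumes "set u \<subseteq> {1, 2}" "count_list u 1 < B" "0 < a"
  shows "\<exists>c. steps mach (2 * length u + a + 2) (conf 0 (int a) (num (Sweep 2 0)) (region_word a) u) c \<and>
    ready a c"
proof -
  define q where "q = int a + int (length u)"
  have "count_list (thin 0 u) 1 = 0"
    using count_thin[of 0 u] two_le_B assms(2) by simp
  then have "1 \<notin> set (thin 0 u)" by (simp add: count_list_0_iff)
  then obtain j where "j < B" and right: "steps mach (length u) (conf 0 (int a) (num (Sweep 2 0)) (region_word a) u)
     (conf 0 q (num (Sweep 2 j)) (rev (thin 0 u) @ region_word a) [])"
    using sweep_right[of 0 2 u 0 "int a" "region_word a" "[]"] assms(1) two_le_B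
    by (auto simp: q_def)
  define v where "v = rev (thin 0 u) @ replicate a blank"
  have reg: "rev (thin 0 u) @ region_word a = v @ origin # replicate (a - 1) blank"
    using assms(3) by (simp add: region_word_def v_def)
  obtain x w where xw: "v = x # w" using assms(3) by (cases v) (auto simp: v_def)
  have set_v: "set v \<subseteq> {1, 2, blank}" using set_thin[of 0 u] by (auto simp: v_def)
  have len_v: "length v = length u + a" by (simp add: v_def)
  have turn: "steps mach 1 (conf 0 q (num (Sweep 2 j)) (rev (thin 0 u) @ region_word a) [])
      (conf 0 (q - 1) (num Final) (w @ origin # replicate (a - 1) blank) [x, 0])"
    unfolding reg xw conf_Nil_right[of _ q] using \<open>j < B\<close> by (intro steps_1) (simp add: step_left)
  have "steps mach (Suc (length w)) (conf 0 (q - 1) (num Final) (w @ origin # replicate (a - 1) blank) (x # [0]))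
      (conf 0 (q - 1 - 1 - int (length w)) (num Final) (replicate (a - 1) blank) (origin # rev w @ x # [0]))"
  proof (rule scan_left_control)
    fix b
    assume "b \<in> set (x # w)"
    then have "b \<noteq> origin" using set_v xw by auto
    then show "act Final b = (Final, b, MLeft)" by simp
  qed simp_all
  moreover have "q - 1 - 1 - int (length w) = -1" "Suc (length w) = length u + a"
    using len_v xw by (auto simp: q_def)
  moreover have "rev w @ x # [0] = replicate a blank @ thin 0 u @ [0]"
    using arg_cong[OF xw, of rev] by (simp add: v_def)
  ultimately have home: "steps mach (length u + a)
      (conf 0 (q - 1) (num Final) (w @ origin # replicate (a - 1) blank) [x, 0])
      (conf 0 (-1) (num Final) (replicate (a - 1) blank) (origin # replicate a blank @ thin 0 u @ [0]))"
    by (simp only:)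
  define c where "c = conf 0 (-1) (num Final) (replicate (a - 1) blank) (origin # replicate a blank @ thin 0 u @ [0])"
  have "step mach c = \<lparr>state = num (Write (length const_word - 1)), head = -2, tape = (tape c)(-1 := blank)\<rparr>"
    using num_ge_2[of Final] by (simp add: c_def step_def delta_num zip_tape_def)
  moreover have "if - int a \<le> i \<and> i < int a then ((tape c)(-1 := blank)) i = blank else ((tape c)(-1 := blank)) i < 3" for i
  proof -
    consider "i = -1" | "i < - int a" | "- int a \<le> i" "i < -1" | "0 \<le> i" "i < int a"
      | "int a \<le> i" by linarith
    then show ?thesis
    proof cases
      case 5
      then obtain k where i: "i = int a + int k" using zle_iff_zadd by blast
      have "nat (i - - 1) = Suc (a + k)" using i by simp
      moreover have "(thin 0 u @ [0]) ! k < 3" if "k < Suc (length u)"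
      proof -
        have "(thin 0 u @ [0]) ! k \<in> set (thin 0 u @ [0])" using that by (intro nth_mem) simp
        then show ?thesis using set_thin[of 0 u] by auto
      qed
      ultimately show ?thesis using i by (auto simp: c_def zip_tape_def nth_append)
    qed (use assms(3) in \<open>auto simp: c_def zip_tape_def nth_append nat_add_distrib split: if_splits\<close>)
  qed
  ultimately have "ready a (step mach c)"
    unfolding ready_def ideal_def by (simp del: fun_upd_apply)
  moreover have "length u + 1 + (length u + a) + 1 = 2 * length u + a + 2" by simp
  ultimately show ?thesis
    using steps_add[OF steps_add[OF steps_add[OF right turn] home] steps_1[OF refl]] unfolding c_def by metis
qed

lemma sweeps:
  assumes "B ^ r \<le> n" "n < B ^ Suc r" "0 < r"
  shows "\<exists>t c. t \<le> r * (4 * n + 3) + 2 * n + 2 \<and> steps mach t (init_config mach (replicate n 1)) c \<and> ready r c"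
proof -
  obtain t u where t: "t \<le> r * (4 * n + 3)" and st: "steps mach t (init_config mach (replicate n 1))
       (conf 0 (int r) (num (Sweep (if r = 0 then 0 else 2) 0)) (region_word r) u)"
    and u: "set u \<subseteq> {1, 2}" and len: "r + length u = n" and count: "count_list u 1 = n div B ^ r"
    using sweep_rounds[OF assms(1)] by blast
  have "count_list u 1 < B" using assms(2) count by (simp add: less_mult_imp_div_less)
  then obtain c where c: "steps mach (2 * length u + r + 2) (conf 0 (int r) (num (Sweep 2 0)) (region_word r) u) c"
    "ready r c" using sweep_final[OF u _ assms(3)] by blast
  have "steps mach (t + (2 * length u + r + 2)) (init_config mach (replicate n 1)) c"
    using steps_add[OF st, of "2 * length u + r + 2" c] c(1) assms(3) by simp
  moreover have "t + (2 * length u + r + 2) \<le> r * (4 * n + 3) + 2 * n + 2" using t len by linarith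
  ultimately show ?thesis using c(2) by blast
qed

section \<open>Running time\<close>

abbreviation region :: "nat \<Rightarrow> int set" where
  "region r \<equiv> {- int r..<int r}"

text \<open>While the head is in the region both runs read the same symbols, and no cell outside is
  written. At time \<open>t\<close> itself the head may be outside.\<close>

lemma ready_agrees:
  assumes "ready r c" "\<And>s. s < t \<Longrightarrow> head ((step mach ^^ s) ideal) \<in> region r"
  shows "state ((step mach ^^ t) c) = state ((step mach ^^ t) ideal) \<and>
    head ((step mach ^^ t) c) = head ((step mach ^^ t) ideal) \<and>
    (\<forall>i. if i \<in> region r then tape ((step mach ^^ t) c) i = tape ((step mach ^^ t) ideal) i
         else tape ((step mach ^^ t) c) i < 3)"
  using assms(2)
proof (induction t)
  case 0
  have "tape ideal i = blank" for i by (simp add: ideal_def conf_blank)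
  then show ?case using assms(1) by (auto simp: ready_def)
next
  case (Suc t)
  define d e where "d = (step mach ^^ t) c" and "e = (step mach ^^ t) ideal"
  have IH: "state d = state e" "head d = head e"
    "\<forall>i. if i \<in> region r then tape d i = tape e i else tape d i < 3"
    using Suc.IH Suc.prems unfolding d_def e_def by auto
  have hd: "head e \<in> region r" using Suc.prems[of t] by (simp add: e_def)
  have "tape d (head d) = tape e (head e)" using IH hd by metis
  then have "state (step mach d) = state (step mach e) \<and> head (step mach d) = head (step mach e) \<and>
    (\<forall>i. if i \<in> region r then tape (step mach d) i = tape (step mach e) i else tape (step mach d) i < 3)"
    using IH hd by (auto simp: step_def split: prod.splits move.splits)
  moreover have "(step mach ^^ Suc t) c = step mach d" "(step mach ^^ Suc t) ideal = step mach e"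
    by (simp_all add: d_def e_def)
  ultimately show ?case by presburger
qed

text \<open>In these states, the machine halts when it sees a symbol outside of the region.\<close>

definition guarded :: "nat set" where
  "guarded = num ` {s \<in> set controls. \<exists>k a j. s \<in> {Write k, Pop k, Push k a j, Back k, Sim k}} \<union> {N..N + K}"

lemma guarded_rejects: "q \<in> guarded \<Longrightarrow> a < 3 \<Longrightarrow> fst (delta mach q a) = 0"
  unfolding guarded_def by (auto simp: delta_num) (auto simp: mach_def)

lemma control_guarded:
  "s \<in> set controls \<Longrightarrow> s \<in> {Write k, Pop k, Push k a j, Back k, Sim k} \<Longrightarrow> num s \<in> guarded"
  unfolding guarded_def by blast

lemma guarded_act:
  assumes "s \<in> set controls" "s \<in> {Write k, Pop k, Push k b j, Back k, Sim k}" "3 \<le> a" "a < S"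
    and "act s a = (s', d, mv)"
  shows "num s' \<in> guarded \<union> {0, num Loop}"
proof (cases "s' \<in> {Rej, Loop, Letter 0}")
  case True
  then show ?thesis by (auto simp: guarded_def)
next
  case False
  have "s' \<in> set controls" using act_wf[OF assms(1,4,5)] False by auto
  moreover have "\<exists>k a j. s' \<in> {Write k, Pop k, Push k a j, Back k, Sim k}"
    using assms(2,3,5) False by (auto simp: resume_def split: if_splits prod.splits)
  ultimately have "num s' \<in> guarded" unfolding guarded_def by blast
  then show ?thesis by blast
qed

lemma guarded_step:
  assumes "q \<in> guarded \<union> {num Loop}" "a < S" "delta mach q a = (q', d, mv)"
  shows "q' \<in> guarded \<union> {0, num Loop}"
proof -
  consider (low) "q \<in> guarded" "a < 3" | (chain) "q \<in> {N..N + K}" "3 \<le> a" | (loop) "q = num Loop"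
    | (control) s k b j where "q = num s" "s \<in> set controls" "3 \<le> a"
        "s \<in> {Write k, Pop k, Push k b j, Back k, Sim k}"
    using assms(1) unfolding guarded_def by (cases "a < 3") auto
  then show ?thesis
  proof cases
    case low
    then show ?thesis using guarded_rejects assms(3) by fastforce
  next
    case chain
    have "num (Pop 0) \<in> guarded" using S_gt by (intro control_guarded) auto
    then show ?thesis using chain assms(3) by (auto simp: mach_def guarded_def split: if_splits)
  next
    case loop
    then show ?thesis using assms(3) by (auto simp: delta_num)
  next
    case control
    obtain s' where "act s a = (s', d, mv)" "q' = num s'"
      using control assms(3) by (auto simp: delta_num split: prod.splits)
    then show ?thesis using guarded_act[of s k b j a s' d mv] control assms(2) by simp
  qed
qed

lemma wf_config_ideal: "wf_config mach ((step mach ^^ t) ideal)"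
proof (rule wf_config_funpow[OF wf_mach])
  have "Write (length const_word - 1) \<in> set controls" using const_word_ne by simp
  then show "wf_config mach ideal"
    using num_wf S_gt by (auto simp: wf_config_def ideal_def conf_blank)
qed

lemma Loop_absorbing: "state c = num Loop \<Longrightarrow> state ((step mach ^^ k) c) = num Loop"
  using num_ge_2[of Loop] by (induction k) (auto simp: step_def delta_num)

text \<open>Closure under steps is \<open>guarded_step\<close>. Hence a run that leaves the region
  without having halted or looped does so in a state that rejects there.\<close>

lemma ideal_guarded: "state ((step mach ^^ t) ideal) \<in> guarded \<union> {0, num Loop}"
proof (induction t)
  case 0
  have "num (Write (length const_word - 1)) \<in> guarded"
    using const_word_ne by (intro control_guarded) auto
  then show ?case by (simp add: ideal_def)
next
  case (Suc t)
  define c where "c = (step mach ^^ t) ideal"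
  obtain q b mv where d: "delta mach (state c) (tape c (head c)) = (q, b, mv)"
    by (cases "delta mach (state c) (tape c (head c))")
  have IH: "state c \<in> guarded \<union> {0, num Loop}" using Suc by (simp only: c_def)
  have a: "tape c (head c) < S" using wf_config_ideal[of t] by (simp add: c_def wf_config_def)
  have "state (step mach c) \<in> guarded \<union> {0, num Loop}"
  proof (cases "halting mach (state c)")
    case True
    then show ?thesis using IH by (simp add: step_def)
  next
    case False
    then have "q \<in> guarded \<union> {0, num Loop}" using IH guarded_step[OF _ a d] by auto
    then show ?thesis using False d by (simp add: step_def)
  qed
  then show ?case by (simp add: c_def)
qed

lemma chain_head:
  assumes "t \<le> length const_word + K"
  shows "head ((step mach ^^ t) ideal) = -2 - int t"
  using chain_phase[OF assms] by (auto simp: steps_def)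

lemma card_region: "card (region r) = 2 * r"
  by simp

text \<open>
  A run that stays long enough in the region to pass through the states \<open>N..N + K\<close> shows that
  the number of states is small compared with the region.
\<close>

lemma ready_halts:
  assumes rejects: "rejects D (encode mach)" and ready: "ready r c" and "0 < r"
  shows "\<exists>t \<le> r + (2 * r) * (2 * r) * S ^ (2 * r) + 1. halting mach (state ((step mach ^^ t) c))"
proof -
  obtain h where h: "state ((step mach ^^ h) ideal) = 0" using ideal_reject[OF rejects] by blast
  then have halts: "halting mach (state ((step mach ^^ h) ideal))" by simp
  have no_loop: "state ((step mach ^^ s) ideal) \<noteq> num Loop" for s
  proof
    assume "state ((step mach ^^ s) ideal) = num Loop"
    then have "state ((step mach ^^ h) ((step mach ^^ s) ideal)) = num Loop" by (rule Loop_absorbing)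
    moreover have "state ((step mach ^^ (s + h)) ideal) = 0"
      using h funpow_step_halted[OF halts] by (simp add: funpow_add)
    ultimately show False using num_ge_2[of Loop] by (simp add: funpow_add add.commute[of s h])
  qed
  \<comment> \<open>The first time with \<open>P\<close> is when the ideal run halts or leaves the
    region; the actual run halts at most one step later.\<close>
  define P where "P t \<longleftrightarrow> halting mach (state ((step mach ^^ t) ideal)) \<or>
    head ((step mach ^^ t) ideal) \<notin> region r" for t
  define t where "t = (LEAST t. P t)"
  have "P h" using halts by (simp add: P_def)
  then have t: "P t" unfolding t_def by (rule LeastI)
  have before: "\<not> P s" if "s < t" for s using that unfolding t_def by (rule not_less_Least)
  have bound: "t \<le> r + (2 * r) * (2 * r) * S ^ (2 * r)"
  proof (cases "r - 1 \<le> length const_word + K")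
    case True
    \<comment> \<open>The writing phase moves left at every step and has brought the head to
      \<open>- r - 1\<close>.\<close>
    then have "P (r - 1)" using chain_head[of "r - 1"] \<open>0 < r\<close> by (simp add: P_def)
    then have "t \<le> r - 1" unfolding t_def by (rule Least_le)
    then show ?thesis by simp
  next
    case False
    \<comment> \<open>Here \<open>K < r\<close>, and the units in \<open>letters\<close> give
      \<open>N \<le> K\<close>.\<close>
    then have "N + K + 1 \<le> 2 * r" using K_ge by simp
    moreover have "t \<le> num_states mach * card (region r) * num_symbols mach ^ card (region r)"
      using before unfolding P_def
      by (intro halting_time_bound[OF wf_mach _ halts]) (use wf_config_ideal[of 0] in auto)
    then have "t \<le> (N + K + 1) * (2 * r) * S ^ (2 * r)"
      unfolding card_region mach_simps .
    moreover have "(N + K + 1) * (2 * r) * S ^ (2 * r) \<le> (2 * r) * (2 * r) * S ^ (2 * r)"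
      using \<open>N + K + 1 \<le> 2 * r\<close> by (intro mult_right_mono) auto
    ultimately show ?thesis by linarith
  qed
  define d where "d = (step mach ^^ t) c"
  define e where "e = (step mach ^^ t) ideal"
  have d: "state d = state e" "head d = head e"
    "\<forall>i. if i \<in> region r then tape d i = tape e i else tape d i < 3"
    using ready_agrees[OF ready, of t] before unfolding P_def d_def e_def by auto
  have "halting mach (state (step mach d))"
  proof (cases "halting mach (state d)")
    case True
    then show ?thesis by (simp add: step_def)
  next
    case False
    then have "head e \<notin> region r" using t d(1) by (simp add: P_def e_def)
    then have "tape d (head d) < 3" using d(2,3) by metis
    moreover have "state d \<in> guarded"
      using ideal_guarded[of t] no_loop[of t] False d(1) by (auto simp: e_def)
    ultimately have "fst (delta mach (state d) (tape d (head d))) = 0"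
      by (intro guarded_rejects)
    then show ?thesis by (auto simp: step_def split: prod.splits)
  qed
  then have "halting mach (state ((step mach ^^ Suc t) c))" by (simp add: d_def)
  then show ?thesis using bound by (intro exI[of _ "Suc t"]) simp
qed

text \<open>The ideal run reaches \<open>Loop\<close> after finitely many steps, visiting finitely
  many cells; any region containing them will do.\<close>

lemma ready_loops:
  assumes accepts: "accepts D (encode mach)"
  shows "\<exists>r0. \<forall>r \<ge> r0. \<forall>c. ready r c \<longrightarrow> (\<exists>t. state ((step mach ^^ t) c) = num Loop)"
proof -
  obtain t where t: "state ((step mach ^^ t) ideal) = num Loop" using ideal_accept[OF accepts] by blast
  have head: "\<bar>head ((step mach ^^ s) ideal)\<bar> \<le> 2 + int s" for s
  proof (induction s)
    case (Suc s)
    have "\<bar>head (step mach e)\<bar> \<le> \<bar>head e\<bar> + 1" for e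
      by (auto simp: step_def split: prod.splits move.splits)
    from this[of "(step mach ^^ s) ideal"] show ?case using Suc by simp
  qed (simp add: ideal_def)
  have "state ((step mach ^^ t) c) = num Loop" if "t + 3 \<le> r" "ready r c" for r c
  proof -
    have "head ((step mach ^^ s) ideal) \<in> region r" if "s < t" for s
      using head[of s] that \<open>t + 3 \<le> r\<close> by (auto simp: abs_le_iff)
    then show ?thesis using ready_agrees[OF that(2), of t] t by simp
  qed
  then show ?thesis by blast
qed

section \<open>Running time on all inputs\<close>

lemma inputs_mach: "replicate n 1 \<in> inputs mach" "w \<in> inputs mach \<Longrightarrow> w = replicate (length w) 1"
proof -
  show "replicate n 1 \<in> inputs mach" by (auto simp: inputs_def)
  assume "w \<in> inputs mach"
  then have "\<forall>y \<in> set w. y = 1" by (auto simp: inputs_def)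
  then show "w = replicate (length w) 1" using replicate_length_same by metis
qed

text \<open>The sweeps cost \<open>O(r * n)\<close>, and \<open>16 * S\<^sup>2 \<le> B\<close> makes
  the number of configurations in the region at most \<open>B ^ r \<le> n\<close>.\<close>

lemma run_halts:
  assumes rejects: "rejects D (encode mach)" and B: "16 * S\<^sup>2 \<le> B" and n: "B \<le> n"
  shows "\<exists>t r. makes_at_most_steps mach (replicate n 1) t \<and> B ^ r \<le> n \<and> t \<le> 14 * r * n"
proof -
  obtain r where r: "B ^ r \<le> n" "n < B ^ Suc r"
    using ex_power_ivl1[of B n] two_le_B n by auto
  then have "0 < r" using n by (cases r) auto
  obtain t c where t: "t \<le> r * (4 * n + 3) + 2 * n + 2"
      "steps mach t (init_config mach (replicate n 1)) c" "ready r c"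
    using sweeps[OF r \<open>0 < r\<close>] by blast
  obtain u where u: "u \<le> r + (2 * r) * (2 * r) * S ^ (2 * r) + 1" "halting mach (state ((step mach ^^ u) c))"
    using ready_halts[OF rejects t(3) \<open>0 < r\<close>] by blast
  have "makes_at_most_steps mach (replicate n 1) (t + u)"
    using t(2) u(2) unfolding makes_at_most_steps_def run_def steps_def
    by (simp add: add.commute[of t] funpow_add)
  moreover have "t + u \<le> 14 * r * n"
  proof -
    \<comment> \<open>The factor \<open>4 * r * r\<close> is absorbed by \<open>16 ^ r\<close>,
      whence the 16 in the bound on \<open>B\<close>.\<close>
    have "r * r \<le> 2 ^ r * 2 ^ r" by (intro mult_mono) (auto simp: less_imp_le)
    also have "\<dots> = 4 ^ r" by (simp flip: power_mult_distrib)
    finally have "4 * (r * r) \<le> 4 ^ r * 4 ^ r"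
      using \<open>0 < r\<close> by (intro mult_mono) (auto simp: self_le_power)
    also have "\<dots> = 16 ^ r" by (simp flip: power_mult_distrib)
    finally have "4 * (r * r) * S ^ (2 * r) \<le> 16 ^ r * S ^ (2 * r)" by (rule mult_right_mono) simp
    also have "\<dots> = (16 * S\<^sup>2) ^ r" by (simp add: power_mult_distrib power_mult)
    also have "\<dots> \<le> B ^ r" using B by (intro power_mono) auto
    also have "\<dots> \<le> n" by (rule r(1))
    finally have 1: "(2 * r) * (2 * r) * S ^ (2 * r) \<le> n" by (simp add: algebra_simps)
    have "1 \<le> n" using n two_le_B by simp
    \<comment> \<open>Every summand is at most a multiple of \<open>r * n\<close>: 7 + 2 + 2 from
      the sweeps and 3 from the rest make 14.\<close>
    then have "r \<le> r * n" "n \<le> r * n" "1 \<le> r * n" using \<open>0 < r\<close> by auto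
    moreover have "r * (4 * n + 3) = 4 * (r * n) + 3 * r" by (simp add: algebra_simps)
    ultimately have "t + u \<le> 14 * (r * n)" using t(1) u(1) 1 by linarith
    then show ?thesis by simp
  qed
  ultimately show ?thesis using r(1) by blast
qed

text \<open>A single input on which the machine loops defeats every time bound, and a long enough
  input gives a sufficient region.\<close>

lemma not_runs_in_time:
  assumes "accepts D (encode mach)"
  shows "\<not> runs_in_time mach T"
proof
  assume run: "runs_in_time mach T"
  obtain r0 where r0: "\<And>r c. r0 \<le> r \<Longrightarrow> ready r c \<Longrightarrow> \<exists>t. state ((step mach ^^ t) c) = num Loop"
    using ready_loops[OF assms] by blast
  define r where "r = Suc r0"
  \<comment> \<open>A power of \<open>B\<close> allows exactly \<open>r\<close> successful
    sweeps.\<close>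
  define n where "n = B ^ r"
  have "n < B ^ Suc r" using two_le_B by (simp add: n_def)
  then obtain t c where t: "steps mach t (init_config mach (replicate n 1)) c" "ready r c"
    using sweeps[of r n] by (auto simp: n_def r_def)
  obtain u where u: "state ((step mach ^^ u) c) = num Loop" using r0[OF _ t(2)] by (auto simp: r_def)
  obtain s where s: "halting mach (state ((step mach ^^ s) (init_config mach (replicate n 1))))"
    using run inputs_mach(1)[of n] unfolding runs_in_time_def makes_at_most_steps_def run_def by auto
  have "(step mach ^^ (s + (u + t))) (init_config mach (replicate n 1)) = (step mach ^^ s) ((step mach ^^ u) c)"
    using t(1) by (simp add: funpow_add steps_def)
  then have "state ((step mach ^^ (s + (u + t))) (init_config mach (replicate n 1))) = num Loop"
    using Loop_absorbing[OF u] by simp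
  moreover have "halting mach (state ((step mach ^^ (s + (u + t))) (init_config mach (replicate n 1))))"
    by (rule halted_mono[OF s]) simp
  ultimately show False using num_ge_2[of Loop] by simp
qed

text \<open>From \<open>B ^ r \<le> n\<close> follows \<open>r * log 2 B \<le> log 2 n\<close>, so
  \<open>14 * r * n\<close> is at most \<open>14 / log 2 B\<close> times \<open>n * log 2 n\<close>.
  Inputs shorter than \<open>B\<close> are covered by the bound \<open>n + 1\<close>.\<close>

lemma runs_in_time_mach:
  fixes T :: "nat \<Rightarrow> real"
  assumes rejects: "rejects D (encode mach)" and B: "16 * S\<^sup>2 \<le> B"
    and small: "\<And>n. real n + 1 \<le> T n"
    and large: "\<And>n. B \<le> n \<Longrightarrow> k * (real n * log 2 (real n)) \<le> T n"
    and k: "14 \<le> k * log 2 (real B)" "0 < k"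
  shows "runs_in_time mach T"
  unfolding runs_in_time_def
proof (intro allI ballI impI)
  fix n w
  assume "w \<in> inputs mach" "length w = n"
  then have w: "w = replicate n 1" using inputs_mach(2) by blast
  show "\<exists>t. real t \<le> T n \<and> makes_at_most_steps mach w t"
  proof (cases "n < B")
    case True
    have "real (n + 1) \<le> T n" using small[of n] by simp
    then show ?thesis using short_input[OF True] w by blast
  next
    case False
    then obtain t r where t: "makes_at_most_steps mach (replicate n 1) t" "B ^ r \<le> n" "t \<le> 14 * r * n"
      using run_halts[OF rejects B, of n] by auto
    have "real B ^ r \<le> real n" using t(2) by (metis of_nat_le_iff of_nat_power)
    then have "log 2 (real B ^ r) \<le> log 2 (real n)"
      using two_le_B by (intro log_mono) auto
    then have r: "real r * log 2 (real B) \<le> log 2 (real n)"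
      using two_le_B by (simp add: log_nat_power)
    have "real t \<le> real (14 * r * n)" using t(3) by (rule of_nat_mono)
    also have "\<dots> = 14 * (real r * real n)" by simp
    also have "\<dots> \<le> (k * log 2 (real B)) * (real r * real n)"
      using k(1) by (intro mult_right_mono) auto
    also have "\<dots> = k * (real n * (real r * log 2 (real B)))" by simp
    also have "\<dots> \<le> k * (real n * log 2 (real n))"
      using r k(2) by (intro mult_left_mono) auto
    also have "\<dots> \<le> T n" using large False by simp
    finally show ?thesis using t(1) w by blast
  qed
qed

end

section \<open>Choice of the thinning factor and contradiction\<close>

theorem theorem4p5:
  fixes T :: "nat \<Rightarrow> real"
  assumes "\<And>n. 0 \<le> T n"
    and "T \<in> \<Omega>(\<lambda>n. real n * log 2 (real n))"
    and "\<And>n. T n \<ge> real n + 1"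
  shows "\<not> (\<exists>D. decides D (\<lambda>M. runs_in_time M T))"
proof
  assume "\<exists>D. decides D (\<lambda>M. runs_in_time M T)"
  then obtain D where D: "decides D (\<lambda>M. runs_in_time M T)" ..
  obtain k where k: "k > 0" "eventually (\<lambda>n. norm (T n) \<ge> k * norm (real n * log 2 (real n))) at_top"
    using assms(2) by (elim landau_omega.bigE)
  then obtain n0 where n0: "\<And>n. n0 \<le> n \<Longrightarrow> norm (T n) \<ge> k * norm (real n * log 2 (real n))"
    by (auto simp: eventually_at_top_linorder)
  obtain b :: nat where b: "2 powr (14 / k) \<le> real b" using real_arch_simple by blast
  \<comment> \<open>The summands serve the assumption \<open>2 \<le> B\<close>, the range of the
    growth bound, \<open>14 \<le> k * log 2 B\<close>, and \<open>16 * S\<^sup>2 \<le> B\<close>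
    with \<open>S\<close> written out.\<close>
  define B where "B = 2 + n0 + b + 16 * (num_symbols D + 10)\<^sup>2"
  interpret construction D B
    using D by unfold_locales (auto simp: decides_def B_def)
  have "14 / k \<le> log 2 (real B)"
  proof -
    have "real b \<le> real B" "0 < real B" by (simp_all add: B_def del: of_nat_add)
    then show ?thesis using b by (simp add: le_log_iff)
  qed
  then have kB: "14 \<le> k * log 2 (real B)" using k(1) by (simp add: field_simps)
  have large: "k * (real n * log 2 (real n)) \<le> T n" if "B \<le> n" for n
  proof -
    have "n0 \<le> n" using that by (simp add: B_def)
    then have "k * norm (real n * log 2 (real n)) \<le> norm (T n)" by (rule n0)
    moreover have "0 \<le> log 2 (real n)" using that by (simp add: B_def)
    ultimately show ?thesis using assms(1)[of n] by simp
  qed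
  have acc: "runs_in_time mach T \<Longrightarrow> accepts D (encode mach)"
    and rej: "\<not> runs_in_time mach T \<Longrightarrow> rejects D (encode mach)"
    using D wf_mach by (auto simp: decides_def)
  show False
  \<comment> \<open>Either verdict of \<open>D\<close> on \<open>mach\<close> makes
    \<open>mach\<close> behave in the opposite way.\<close>
  proof (cases "runs_in_time mach T")
    case True
    then show False using not_runs_in_time[OF acc] by blast
  next
    case False
    have "16 * S\<^sup>2 \<le> B" by (simp add: S_def B_def)
    then show False
      using False runs_in_time_mach[OF rej[OF False] _ assms(3) large kB k(1)] by blast
  qed
qed

end
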